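(* Let $X$ be the generator of a projectively Anosov flow on $M$ and let $\|\cdot\|$ be some $X$-differentiable norm on $TM$, induced by a metric. Let $r_s$ and $r_u$ be the expansion rates of the stable and unstable bundles, measured by $\|\cdot\|$. Then: (a) there exists a volume form $\Omega$ on $M$ which is $X$-differentiable and satisfies $div_X\Omega=r_s+r_u$; (b) for any $\epsilon>0$, there exists a $C^1$ volume form $\Omega^\epsilon$ on $M$ such that $|div_X\Omega^\epsilon-(r_s+r_u)|<\epsilon$.
   Context: Standing assumptions: $M$ is a closed connected oriented 3-manifold; $X$ is a non-vanishing $C^{1+}$ vector field on $M$ ($C^1$ with Hölder continuous derivatives) with flow $\phi^t$; the invariant bundles of the flow are transversely orientable. The flow induces a flow $\tilde\phi^t_*$ on $TM/\langle X\rangle$ via $\pi:TM\to TM/\langle X\rangle$. The flow is projectively Anosov if there is a continuous splitting into line bundles $TM/\langle X\rangle\simeq E^s\oplus E^u$, invariant under $\tilde\phi^t_*$, such that for some constant $C>0$ and some norm $\|\cdot\|$, $\|\tilde\phi^t_*(v)\|/\|\tilde\phi^t_*(u)\|\ge e^{Ct}\|v\|/\|u\|$ for all $t\ge 0$ and all nonzero $u\in E^s$, $v\in E^u$ over the same point. $E^s$ and $E^u$ are called the stable and unstable directions (bundles). A geometric quantity (function, form, norm, ...) is called $X$-differentiable if it is differentiable in the direction of the flow of $X$. Volume forms are a priori only $C^0$. For an $X$-differentiable volume form $\Omega$, $div_X\Omega$ is the function with $\mathcal L_X\Omega=(div_X\Omega)\,\Omega$. Expansion rates: given an $X$-differentiable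 norm on $TM/\langle X\rangle$, let $\tilde e_s\in E^s$, $\tilde e_u\in E^u$ be unit vectors and set $r_s=\frac{\partial}{\partial t}\ln\|\tilde\phi^t_*(\tilde e_s)\|\big|_{t=0}$, $r_u=\frac{\partial}{\partial t}\ln\|\tilde\phi^t_*(\tilde e_u)\|\big|_{t=0}$. Metrics on $TM/\langle X\rangle$ and on $TM$ are related as follows: for a $C^1$ plane field $\eta$ transverse to $X$, the projection identifies $\eta$ with $TM/\langle X\rangle$, and a metric on $TM/\langle X\rangle$ then gives a metric on $\eta$, extended to $TM$ by $\|X\|=1$ and $X\perp\eta$; through this correspondence the expansion rates are also said to be measured by the norm on $TM$.
   Formalization: "X-differentiable" is read as: the derivative along the flow exists and is continuous, for the given norm and for the volume form in (a); with mere existence of the derivative, r_s+r_u can be discontinuous and (b) fails. *)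

theory Defs
  imports "HOL-Analysis.Analysis"
begin

section \<open>Maps of class \<open>C\<^sup>k\<close> between open subsets of normed spaces\<close>

primrec Ck_on :: "nat \<Rightarrow> ('a::real_normed_vector \<Rightarrow> 'b::real_normed_vector) \<Rightarrow> 'a set \<Rightarrow> bool" where
  "Ck_on 0 f S \<longleftrightarrow> continuous_on S f"
| "Ck_on (Suc n) f S \<longleftrightarrow>
     (\<exists>f'. (\<forall>x\<in>S. (f has_derivative f' x) (at x)) \<and> (\<forall>v. Ck_on n (\<lambda>x. f' x v) S))"

section \<open>Closed connected oriented 3-manifolds\<close>

type_synonym 'm chart = "'m set \<times> ('m \<Rightarrow> real^3)"

definition cdom :: "'m chart \<Rightarrow> 'm set" where "cdom c = fst c"

definition cmap :: "'m chart \<Rightarrow> 'm \<Rightarrow> real^3" where "cmap c = snd c"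

definition cimg :: "'m chart \<Rightarrow> (real^3) set" where "cimg c = cmap c ` cdom c"

definition cinv :: "'m chart \<Rightarrow> real^3 \<Rightarrow> 'm" where "cinv c = inv_into (cdom c) (cmap c)"

definition oriented_smooth_atlas :: "('m::t2_space) chart set \<Rightarrow> bool" where
  "oriented_smooth_atlas A \<longleftrightarrow>
     (\<Union>c\<in>A. cdom c) = UNIV \<and>
     (\<forall>c\<in>A. open (cdom c) \<and> open (cimg c) \<and> homeomorphism (cdom c) (cimg c) (cmap c) (cinv c)) \<and>
     (\<forall>c\<in>A. \<forall>d\<in>A. \<forall>n. Ck_on n (cmap d \<circ> cinv c) (cmap c ` (cdom c \<inter> cdom d))) \<and>
     (\<forall>c\<in>A. \<forall>d\<in>A. \<forall>x \<in> cmap c ` (cdom c \<inter> cdom d).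
        det (matrix (frechet_derivative (cmap d \<circ> cinv c) (at x))) > 0)"

text \<open>The manifold is the whole type; second countability follows from compactness.\<close>

definition closed_connected_oriented_3manifold :: "('m::t2_space) chart set \<Rightarrow> bool" where
  "closed_connected_oriented_3manifold A \<longleftrightarrow>
     compact (UNIV :: 'm set) \<and> connected (UNIV :: 'm set) \<and> oriented_smooth_atlas A"

section \<open>Tangent vectors\<close>

text \<open>
  The tangent space at \<open>p\<close> is identified with \<open>real^3\<close> by means of a preferred chart around
  \<open>p\<close>.  The preferred chart need not depend continuously on \<open>p\<close>, so a family of vectors
  \<open>X p :: real^3\<close> is never compared for different \<open>p\<close> directly: continuity and
  differentiability always refer to the coordinates \<open>tcoord A c p (X p)\<close> in a fixed chart \<open>c\<close>,
  given by the usual transformation law.  The map \<open>tvec A c p\<close> is the inverse of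
  \<open>tcoord A c p\<close>: it sends coordinates in the chart \<open>c\<close> to the tangent vector at \<open>p\<close>.
\<close>

definition pchart :: "'m chart set \<Rightarrow> 'm \<Rightarrow> 'm chart" where
  "pchart A p = (SOME c. c \<in> A \<and> p \<in> cdom c)"

definition tcoord :: "'m chart set \<Rightarrow> 'm chart \<Rightarrow> 'm \<Rightarrow> real^3 \<Rightarrow> real^3" where
  "tcoord A c p = frechet_derivative (cmap c \<circ> cinv (pchart A p)) (at (cmap (pchart A p) p))"

definition tvec :: "'m chart set \<Rightarrow> 'm chart \<Rightarrow> 'm \<Rightarrow> real^3 \<Rightarrow> real^3" where
  "tvec A c p = frechet_derivative (cmap (pchart A p) \<circ> cinv c) (at (cmap c p))"

text \<open>The differential of a map of the manifold into itself.\<close>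

definition differential :: "'m chart set \<Rightarrow> ('m \<Rightarrow> 'm) \<Rightarrow> 'm \<Rightarrow> real^3 \<Rightarrow> real^3" where
  "differential A f p =
     frechet_derivative (cmap (pchart A (f p)) \<circ> f \<circ> cinv (pchart A p)) (at (cmap (pchart A p) p))"

section \<open>Vector fields and flows\<close>

definition vf_in_chart :: "'m chart set \<Rightarrow> 'm chart \<Rightarrow> ('m \<Rightarrow> real^3) \<Rightarrow> real^3 \<Rightarrow> real^3" where
  "vf_in_chart A c X x = tcoord A c (cinv c x) (X (cinv c x))"

definition continuous_vf_on :: "('m::t2_space) chart set \<Rightarrow> 'm set \<Rightarrow> ('m \<Rightarrow> real^3) \<Rightarrow> bool" where
  "continuous_vf_on A U X \<longleftrightarrow>
     (\<forall>c\<in>A. continuous_on (cmap c ` (cdom c \<inter> U)) (vf_in_chart A c X))"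

text \<open>Class \<open>C\<^sup>1\<^sup>+\<close>: continuously differentiable with (locally) Hoelder continuous derivative.\<close>

definition C1plus_vf :: "('m::t2_space) chart set \<Rightarrow> ('m \<Rightarrow> real^3) \<Rightarrow> bool" where
  "C1plus_vf A X \<longleftrightarrow>
     (\<forall>c\<in>A. Ck_on 1 (vf_in_chart A c X) (cimg c)) \<and>
     (\<exists>\<alpha>. 0 < \<alpha> \<and> \<alpha> \<le> 1 \<and>
        (\<forall>c\<in>A. \<forall>K. compact K \<and> K \<subseteq> cimg c \<longrightarrow>
           (\<exists>C. \<forall>x\<in>K. \<forall>y\<in>K.
              onorm (\<lambda>v. frechet_derivative (vf_in_chart A c X) (at x) v
                       - frechet_derivative (vf_in_chart A c X) (at y) v)
                \<le> C * dist x y powr \<alpha>)))"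

text \<open>
  A global flow with generator \<open>X\<close>.  For a \<open>C\<^sup>1\<close> vector field on a closed manifold such a flow
  exists, is unique, and is jointly \<open>C\<^sup>1\<close>; the regularity is recorded here as part of the notion
  of flow because differentials of the time-\<open>t\<close> maps are used throughout.
\<close>

definition flow_of :: "('m::t2_space) chart set \<Rightarrow> ('m \<Rightarrow> real^3) \<Rightarrow> (real \<Rightarrow> 'm \<Rightarrow> 'm) \<Rightarrow> bool" where
  "flow_of A X \<phi> \<longleftrightarrow>
     (\<forall>p. \<phi> 0 p = p) \<and>
     (\<forall>s t p. \<phi> (s + t) p = \<phi> s (\<phi> t p)) \<and>
     continuous_on UNIV (\<lambda>(t, p). \<phi> t p) \<and>
     (\<forall>c\<in>A. \<forall>d\<in>A. Ck_on 1 (\<lambda>(t, x). cmap d (\<phi> t (cinv c x)))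
        {(t, x). x \<in> cimg c \<and> \<phi> t (cinv c x) \<in> cdom d}) \<and>
     (\<forall>p. ((\<lambda>t. cmap (pchart A p) (\<phi> t p)) has_vector_derivative X p) (at 0))"

section \<open>The bundle \<open>TM/\<langle>X\<rangle>\<close>\<close>

text \<open>
  The fibre of \<open>TM/\<langle>X\<rangle>\<close> over \<open>p\<close> consists of the cosets of the line spanned by \<open>X p\<close>;
  \<open>coset X p\<close> is the projection \<open>\<pi>\<close>.  The action of the flow on \<open>TM/\<langle>X\<rangle>\<close> is
  \<open>K \<mapsto> differential A (\<phi> t) p ` K\<close>.
\<close>

definition coset :: "('m \<Rightarrow> real^3) \<Rightarrow> 'm \<Rightarrow> real^3 \<Rightarrow> (real^3) set" where
  "coset X p v = {v + a *\<^sub>R X p | a. True}"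

definition flow_on_quotient ::
    "'m chart set \<Rightarrow> (real \<Rightarrow> 'm \<Rightarrow> 'm) \<Rightarrow> real \<Rightarrow> 'm \<Rightarrow> (real^3) set \<Rightarrow> (real^3) set" where
  "flow_on_quotient A \<phi> t p K = differential A (\<phi> t) p ` K"

definition continuous_line_subbundle ::
    "('m::t2_space) chart set \<Rightarrow> ('m \<Rightarrow> real^3) \<Rightarrow> ('m \<Rightarrow> (real^3) set set) \<Rightarrow> bool" where
  "continuous_line_subbundle A X E \<longleftrightarrow>
     (\<forall>p. \<exists>U w. open U \<and> p \<in> U \<and> continuous_vf_on A U w \<and>
        (\<forall>q\<in>U. coset X q (w q) \<noteq> coset X q 0 \<and> E q = {coset X q (a *\<^sub>R w q) | a. True}))"

definition splits_quotient ::
    "('m \<Rightarrow> real^3) \<Rightarrow> ('m \<Rightarrow> (real^3) set set) \<Rightarrow> ('m \<Rightarrow> (real^3) set set) \<Rightarrow> bool" where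
  "splits_quotient X Es Eu \<longleftrightarrow>
     (\<forall>p v. \<exists>!KL \<in> Es p \<times> Eu p. coset X p v = {x + y | x y. x \<in> fst KL \<and> y \<in> snd KL})"

definition quotient_bundle_norm ::
    "('m::t2_space) chart set \<Rightarrow> ('m \<Rightarrow> real^3) \<Rightarrow> ('m \<Rightarrow> (real^3) set \<Rightarrow> real) \<Rightarrow> bool" where
  "quotient_bundle_norm A X n \<longleftrightarrow>
     (\<forall>p v. 0 \<le> n p (coset X p v)) \<and>
     (\<forall>p v. n p (coset X p v) = 0 \<longleftrightarrow> coset X p v = coset X p 0) \<and>
     (\<forall>p a v. n p (coset X p (a *\<^sub>R v)) = \<bar>a\<bar> * n p (coset X p v)) \<and>
     (\<forall>p v w. n p (coset X p (v + w)) \<le> n p (coset X p v) + n p (coset X p w)) \<and>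
     (\<forall>c\<in>A. continuous_on (cimg c \<times> UNIV)
        (\<lambda>(x, v). n (cinv c x) (coset X (cinv c x) (tvec A c (cinv c x) v))))"

section \<open>Projectively Anosov flows\<close>

definition projectively_anosov ::
    "('m::t2_space) chart set \<Rightarrow> ('m \<Rightarrow> real^3) \<Rightarrow> (real \<Rightarrow> 'm \<Rightarrow> 'm) \<Rightarrow>
     ('m \<Rightarrow> (real^3) set set) \<Rightarrow> ('m \<Rightarrow> (real^3) set set) \<Rightarrow> bool" where
  "projectively_anosov A X \<phi> Es Eu \<longleftrightarrow>
     continuous_line_subbundle A X Es \<and> continuous_line_subbundle A X Eu \<and>
     splits_quotient X Es Eu \<and>
     (\<forall>t p. flow_on_quotient A \<phi> t p ` Es p = Es (\<phi> t p)) \<and>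
     (\<forall>t p. flow_on_quotient A \<phi> t p ` Eu p = Eu (\<phi> t p)) \<and>
     (\<exists>C n. C > 0 \<and> quotient_bundle_norm A X n \<and>
        (\<forall>p. \<forall>u \<in> Es p - {coset X p 0}. \<forall>v \<in> Eu p - {coset X p 0}. \<forall>t\<ge>0.
           n (\<phi> t p) (flow_on_quotient A \<phi> t p v) / n (\<phi> t p) (flow_on_quotient A \<phi> t p u)
             \<ge> exp (C * t) * (n p v / n p u)))"

text \<open>
  The invariant plane field in \<open>TM\<close> determined by a line subbundle \<open>E\<close> of \<open>TM/\<langle>X\<rangle>\<close> is its
  preimage under the projection, that is, the union of the cosets belonging to \<open>E\<close>.  A plane field
  is transversely orientable if it is the kernel of a (continuous) 1-form.
\<close>

definition plane_field_of :: "('m \<Rightarrow> (real^3) set set) \<Rightarrow> 'm \<Rightarrow> (real^3) set" where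
  "plane_field_of E p = \<Union>(E p)"

definition transversely_orientable ::
    "('m::t2_space) chart set \<Rightarrow> ('m \<Rightarrow> (real^3) set) \<Rightarrow> bool" where
  "transversely_orientable A \<eta> \<longleftrightarrow>
     (\<exists>\<alpha> :: 'm \<Rightarrow> real^3 \<Rightarrow> real.
        (\<forall>p. linear (\<alpha> p) \<and> \<eta> p = {v. \<alpha> p v = 0}) \<and>
        (\<forall>c\<in>A. \<forall>i. continuous_on (cimg c)
           (\<lambda>x. \<alpha> (cinv c x) (tvec A c (cinv c x) (axis i 1)))))"

section \<open>Metrics and expansion rates\<close>

definition riemannian_metric ::
    "('m::t2_space) chart set \<Rightarrow> ('m \<Rightarrow> real^3 \<Rightarrow> real^3 \<Rightarrow> real) \<Rightarrow> bool" where
  "riemannian_metric A g \<longleftrightarrow>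
     (\<forall>p. bilinear (g p)) \<and>
     (\<forall>p u v. g p u v = g p v u) \<and>
     (\<forall>p v. v \<noteq> 0 \<longrightarrow> g p v v > 0) \<and>
     (\<forall>c\<in>A. \<forall>i j. continuous_on (cimg c)
        (\<lambda>x. g (cinv c x) (tvec A c (cinv c x) (axis i 1)) (tvec A c (cinv c x) (axis j 1))))"

definition metric_norm :: "('m \<Rightarrow> real^3 \<Rightarrow> real^3 \<Rightarrow> real) \<Rightarrow> 'm \<Rightarrow> real^3 \<Rightarrow> real" where
  "metric_norm g p v = sqrt (g p v v)"

text \<open>
  Differentiability in the direction of the flow: the Lie derivative along \<open>X\<close> exists and is,
  like the quantity itself, continuous.  A norm is differentiated away from the zero section.
\<close>

definition X_differentiable_norm ::
    "('m::t2_space) chart set \<Rightarrow> (real \<Rightarrow> 'm \<Rightarrow> 'm) \<Rightarrow> ('m \<Rightarrow> real^3 \<Rightarrow> real) \<Rightarrow> bool" where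
  "X_differentiable_norm A \<phi> N \<longleftrightarrow>
     (\<exists>N'. (\<forall>p v. v \<noteq> 0 \<longrightarrow>
              ((\<lambda>t. N (\<phi> t p) (differential A (\<phi> t) p v)) has_real_derivative N' p v) (at 0)) \<and>
           (\<forall>c\<in>A. continuous_on (cimg c \<times> (- {0}))
              (\<lambda>(x, v). N' (cinv c x) (tvec A c (cinv c x) v))))"

text \<open>
  The norm on \<open>TM/\<langle>X\<rangle>\<close> corresponding to a metric on \<open>TM\<close>: \<open>TM/\<langle>X\<rangle>\<close> is identified with the
  orthogonal complement of \<open>X\<close>, every coset having exactly one representative orthogonal to \<open>X\<close>.
  If the metric on \<open>TM\<close> is the extension of a metric on \<open>TM/\<langle>X\<rangle>\<close> by means of a transverse plane
  field \<open>\<eta>\<close>, with \<open>X\<close> a unit field orthogonal to \<open>\<eta>\<close>, this gives back the original norm, see the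
  lemma below.
\<close>

definition quotient_norm ::
    "('m \<Rightarrow> real^3) \<Rightarrow> ('m \<Rightarrow> real^3 \<Rightarrow> real^3 \<Rightarrow> real) \<Rightarrow> 'm \<Rightarrow> (real^3) set \<Rightarrow> real" where
  "quotient_norm X g p K = metric_norm g p (THE v. v \<in> K \<and> g p v (X p) = 0)"

lemma quotient_norm_coset:
  assumes g: "riemannian_metric A g" and X: "X p \<noteq> 0"
    and v: "g p v (X p) = 0"
  shows "quotient_norm X g p (coset X p v) = metric_norm g p v"
proof -
  have bil: "bilinear (g p)" and pos: "g p (X p) (X p) > 0"
    using g X by (auto simp: riemannian_metric_def)
  have "(THE w. w \<in> coset X p v \<and> g p w (X p) = 0) = v"
  proof (rule the_equality)
    show "v \<in> coset X p v \<and> g p v (X p) = 0"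
      using v by (auto simp: coset_def intro: exI[of _ 0])
  next
    fix w assume w: "w \<in> coset X p v \<and> g p w (X p) = 0"
    then obtain a where a: "w = v + a *\<^sub>R X p" by (auto simp: coset_def)
    have "g p w (X p) = g p v (X p) + a * g p (X p) (X p)"
      using bil by (simp add: a bilinear_ladd bilinear_lmul)
    then have "a = 0" using w v pos by simp
    then show "w = v" by (simp add: a)
  qed
  then show ?thesis by (simp add: quotient_norm_def)
qed

definition expansion_rate ::
    "'m chart set \<Rightarrow> (real \<Rightarrow> 'm \<Rightarrow> 'm) \<Rightarrow> ('m \<Rightarrow> (real^3) set \<Rightarrow> real) \<Rightarrow>
     ('m \<Rightarrow> (real^3) set set) \<Rightarrow> 'm \<Rightarrow> real" where
  "expansion_rate A \<phi> n E p =
     deriv (\<lambda>t. ln (n (\<phi> t p) (flow_on_quotient A \<phi> t p (SOME e. e \<in> E p \<and> n p e = 1)))) 0"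

section \<open>Volume forms and divergence\<close>

definition vol_coeff ::
    "'m chart set \<Rightarrow> 'm chart \<Rightarrow> ('m \<Rightarrow> real^3 \<Rightarrow> real^3 \<Rightarrow> real^3 \<Rightarrow> real) \<Rightarrow> real^3 \<Rightarrow> real" where
  "vol_coeff A c \<Omega> x =
     \<Omega> (cinv c x) (tvec A c (cinv c x) (axis 1 1)) (tvec A c (cinv c x) (axis 2 1))
       (tvec A c (cinv c x) (axis 3 1))"

text \<open>A volume form is a nowhere vanishing 3-form, a priori only continuous.\<close>

definition volume_form ::
    "('m::t2_space) chart set \<Rightarrow> ('m \<Rightarrow> real^3 \<Rightarrow> real^3 \<Rightarrow> real^3 \<Rightarrow> real) \<Rightarrow> bool" where
  "volume_form A \<Omega> \<longleftrightarrow>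
     (\<forall>p v w. linear (\<lambda>u. \<Omega> p u v w) \<and> linear (\<lambda>u. \<Omega> p v u w) \<and> linear (\<lambda>u. \<Omega> p v w u)) \<and>
     (\<forall>p u v. \<Omega> p u u v = 0 \<and> \<Omega> p u v u = 0 \<and> \<Omega> p v u u = 0) \<and>
     (\<forall>p. \<exists>u v w. \<Omega> p u v w \<noteq> 0) \<and>
     (\<forall>c\<in>A. continuous_on (cimg c) (vol_coeff A c \<Omega>))"

definition C1_volume_form ::
    "('m::t2_space) chart set \<Rightarrow> ('m \<Rightarrow> real^3 \<Rightarrow> real^3 \<Rightarrow> real^3 \<Rightarrow> real) \<Rightarrow> bool" where
  "C1_volume_form A \<Omega> \<longleftrightarrow>
     volume_form A \<Omega> \<and> (\<forall>c\<in>A. Ck_on 1 (vol_coeff A c \<Omega>) (cimg c))"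

text \<open>\<open>has_lie_derivative A \<phi> \<Omega> \<Lambda>\<close>: the derivative at \<open>t = 0\<close> of the pullback of \<open>\<Omega>\<close> by \<open>\<phi> t\<close> is \<open>\<Lambda>\<close>.\<close>

definition has_lie_derivative ::
    "'m chart set \<Rightarrow> (real \<Rightarrow> 'm \<Rightarrow> 'm) \<Rightarrow>
     ('m \<Rightarrow> real^3 \<Rightarrow> real^3 \<Rightarrow> real^3 \<Rightarrow> real) \<Rightarrow>
     ('m \<Rightarrow> real^3 \<Rightarrow> real^3 \<Rightarrow> real^3 \<Rightarrow> real) \<Rightarrow> bool" where
  "has_lie_derivative A \<phi> \<Omega> \<Lambda> \<longleftrightarrow>
     (\<forall>p u v w.
        ((\<lambda>t. \<Omega> (\<phi> t p) (differential A (\<phi> t) p u) (differential A (\<phi> t) p v)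
                 (differential A (\<phi> t) p w))
         has_real_derivative \<Lambda> p u v w) (at 0))"

definition X_differentiable_form ::
    "('m::t2_space) chart set \<Rightarrow> (real \<Rightarrow> 'm \<Rightarrow> 'm) \<Rightarrow>
     ('m \<Rightarrow> real^3 \<Rightarrow> real^3 \<Rightarrow> real^3 \<Rightarrow> real) \<Rightarrow> bool" where
  "X_differentiable_form A \<phi> \<Omega> \<longleftrightarrow>
     (\<exists>\<Lambda>. has_lie_derivative A \<phi> \<Omega> \<Lambda> \<and> (\<forall>c\<in>A. continuous_on (cimg c) (vol_coeff A c \<Lambda>)))"

definition has_divergence ::
    "'m chart set \<Rightarrow> (real \<Rightarrow> 'm \<Rightarrow> 'm) \<Rightarrow>
     ('m \<Rightarrow> real^3 \<Rightarrow> real^3 \<Rightarrow> real^3 \<Rightarrow> real) \<Rightarrow> ('m \<Rightarrow> real) \<Rightarrow> bool" where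
  "has_divergence A \<phi> \<Omega> \<delta> \<longleftrightarrow> has_lie_derivative A \<phi> \<Omega> (\<lambda>p u v w. \<delta> p * \<Omega> p u v w)"

end

theory Submission
  imports Defs
begin

text \<open>
  Near every point choose vectors \<open>e\<^sub>s\<close>, \<open>e\<^sub>u\<close> orthogonal to \<open>X\<close> that represent unit vectors of
  \<open>E\<^sup>s\<close> and \<open>E\<^sup>u\<close>; they are unique up to sign and can be chosen continuously.  Let \<open>\<Omega>\<close> be the positive
  volume form with \<open>\<bar>\<Omega>(X, e\<^sub>s, e\<^sub>u)\<bar> = 1\<close>.  The flow preserves \<open>X\<close> and, modulo \<open>X\<close>, multiplies \<open>e\<^sub>s\<close>
  and \<open>e\<^sub>u\<close> up to sign by factors \<open>n\<^sub>s(t)\<close>, \<open>n\<^sub>u(t)\<close> whose logarithmic derivatives at \<open>t = 0\<close> are the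
  expansion rates.  Multiples of \<open>X\<close> do not change the value of \<open>\<Omega>\<close>, so the pullback of \<open>\<Omega>\<close> is
  \<open>n\<^sub>s(t) n\<^sub>u(t) \<Omega>\<close>, and its divergence is \<open>r\<^sub>s + r\<^sub>u\<close>; this is
  \<open>ex_volume_density_with_divergence_sum_of_rates\<close>.  The metric is differentiable along the flow by
  polarisation, which makes \<open>n\<^sub>s\<close> and \<open>n\<^sub>u\<close> differentiable, and the rates turn out to be values of the
  derivative of the norm at \<open>e\<^sub>s\<close>, \<open>e\<^sub>u\<close>, whence they are continuous.

  The second part holds for every continuous volume form \<open>\<Omega>\<close> with continuous divergence \<open>\<delta>\<close>
  (\<open>C1_volume_form_with_nearby_divergence\<close>).  Fix a \<open>C\<^sup>1\<close> volume form \<open>\<Omega>\<^sub>0\<close>.  Its divergence \<open>\<delta>\<^sub>0\<close> exists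
  and is continuous, because the differential of the flow of a \<open>C\<^sup>1\<close> field solves the variational
  equation.  The function \<open>h\<^sub>0 = ln (\<Omega> / \<Omega>\<^sub>0)\<close> has derivative \<open>k = \<delta> - \<delta>\<^sub>0\<close> along the flow, and it remains
  to find a \<open>C\<^sup>1\<close> function \<open>h\<close> whose derivative along the flow is uniformly close to \<open>k\<close>, since then
  \<open>exp h \<Omega>\<^sub>0\<close> is the desired form.  A uniform approximation of \<open>h\<^sub>0\<close> says nothing about derivatives,
  but the time average \<open>h(p) = 1/T \<integral>\<^sub>0\<^sup>T h\<^sub>1(\<phi>\<^sup>s p) ds\<close> of a \<open>C\<^sup>1\<close> function \<open>h\<^sub>1\<close> is again \<open>C\<^sup>1\<close>, and
  its derivative along the flow is the difference quotient \<open>(h\<^sub>1(\<phi>\<^sup>T p) - h\<^sub>1(p)) / T\<close>, in which no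
  derivative of \<open>h\<^sub>1\<close> occurs.  So one first takes \<open>T\<close> so small that the difference quotients of \<open>h\<^sub>0\<close>
  are close to \<open>k\<close>, and then \<open>h\<^sub>1\<close> so close to \<open>h\<^sub>0\<close> that the error remains small after the division
  by \<open>T\<close>; such \<open>h\<^sub>1\<close> exist by the Stone-Weierstrass theorem.
\<close>

section \<open>Maps of class \<open>C\<^sup>1\<close>\<close>

lemma Ck_on_1I:
  assumes "\<And>x. x \<in> S \<Longrightarrow> (f has_derivative f' x) (at x)"
    and "\<And>v. continuous_on S (\<lambda>x. f' x v)"
  shows "Ck_on 1 f S"
  using assms unfolding One_nat_def Ck_on.simps by blast

lemma Ck_on_1_derivative:
  assumes "Ck_on 1 f S" "x \<in> S"
  shows "(f has_derivative frechet_derivative f (at x)) (at x)"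
proof -
  have "f differentiable at x"
    using assms unfolding One_nat_def Ck_on.simps differentiable_def by blast
  then show ?thesis
    by (simp only: frechet_derivative_works)
qed

lemma Ck_on_Suc_derivative:
  assumes "Ck_on (Suc n) f S" and S: "open S"
  shows "Ck_on n (\<lambda>x. frechet_derivative f (at x) v) S"
proof -
  obtain f' where f': "\<forall>x\<in>S. (f has_derivative f' x) (at x)" "\<forall>v. Ck_on n (\<lambda>x. f' x v) S"
    using assms by auto
  have eq: "f' x = frechet_derivative f (at x)" if "x \<in> S" for x
    using f'(1) that frechet_derivative_at by blast
  have cong: "Ck_on n g S \<Longrightarrow> (\<And>x. x \<in> S \<Longrightarrow> g x = h x) \<Longrightarrow> Ck_on n h S" for g h :: "'a \<Rightarrow> 'b"
  proof (cases n)
    case (Suc m)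
    assume g: "Ck_on n g S" and gh: "\<And>x. x \<in> S \<Longrightarrow> g x = h x"
    then obtain g' where "\<forall>x\<in>S. (g has_derivative g' x) (at x)" "\<forall>v. Ck_on m (\<lambda>x. g' x v) S"
      by (auto simp: Suc)
    moreover from this(1) have "\<forall>x\<in>S. (h has_derivative g' x) (at x)"
      using has_derivative_transform_within_open[OF _ S] gh by blast
    ultimately show "Ck_on n h S"
      by (auto simp: Suc)
  qed (auto cong: continuous_on_cong)
  show ?thesis
    using f'(2) cong[of "\<lambda>x. f' x v" "\<lambda>x. frechet_derivative f (at x) v"] eq by simp
qed

lemma Ck_on_1_continuous_derivative:
  assumes "Ck_on 1 f S"
  shows "continuous_on S (\<lambda>x. frechet_derivative f (at x) v)"
proof -
  obtain f' where f': "\<forall>x\<in>S. (f has_derivative f' x) (at x)" "\<forall>v. continuous_on S (\<lambda>x. f' x v)"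
    using assms unfolding One_nat_def Ck_on.simps by blast
  show ?thesis
    using f'(2)[rule_format, of v]
    by (rule continuous_on_eq) (simp add: frechet_derivative_at[OF f'(1)[rule_format], symmetric])
qed

lemma Ck_on_1_continuous:
  assumes "Ck_on 1 f S"
  shows "continuous_on S f"
  using has_derivative_continuous[OF Ck_on_1_derivative[OF assms]]
  by (blast intro: continuous_at_imp_continuous_on)

lemma Ck_on_1_subset:
  assumes "Ck_on 1 f S" "T \<subseteq> S"
  shows "Ck_on 1 f T"
  by (rule Ck_on_1I[where f' = "\<lambda>x. frechet_derivative f (at x)"])
     (use assms Ck_on_1_derivative Ck_on_1_continuous_derivative continuous_on_subset in \<open>blast+\<close>)

lemma Ck_on_1_transform:
  assumes "Ck_on 1 f S" "open S" "\<And>x. x \<in> S \<Longrightarrow> f x = g x"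
  shows "Ck_on 1 g S"
proof (rule Ck_on_1I)
  show "(g has_derivative frechet_derivative f (at x)) (at x)" if "x \<in> S" for x
    using has_derivative_transform_within_open[OF Ck_on_1_derivative[OF assms(1) that] assms(2) that]
      assms(3) by blast
qed (rule Ck_on_1_continuous_derivative[OF assms(1)])

lemma Ck_on_1_locally:
  assumes "\<And>x. x \<in> S \<Longrightarrow> \<exists>U. open U \<and> x \<in> U \<and> Ck_on 1 f U"
  shows "Ck_on 1 f S"
proof (rule Ck_on_1I)
  fix x assume "x \<in> S"
  then show "(f has_derivative frechet_derivative f (at x)) (at x)"
    using assms Ck_on_1_derivative by blast
next
  fix v
  show "continuous_on S (\<lambda>x. frechet_derivative f (at x) v)"
    by (rule continuous_at_imp_continuous_on)
       (use assms Ck_on_1_continuous_derivative continuous_on_eq_continuous_at in blast)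
qed

text \<open>
  In finite dimension a family of linear maps that is continuous for each basis vector is continuous
  jointly, since the vector enters through finitely many coordinates.
\<close>

lemma continuous_on_linear_family:
  fixes L :: "'a::topological_space \<Rightarrow> 'b::euclidean_space \<Rightarrow> 'c::real_normed_vector"
  assumes lin: "\<And>y. y \<in> T \<Longrightarrow> linear (L (h y))"
    and cont: "\<And>b. b \<in> Basis \<Longrightarrow> continuous_on S (\<lambda>x. L x b)"
    and h: "continuous_on T h" "\<And>y. y \<in> T \<Longrightarrow> h y \<in> S" and k: "continuous_on T k"
  shows "continuous_on T (\<lambda>y. L (h y) (k y))"
proof -
  have eq: "L (h y) (k y) = (\<Sum>b\<in>Basis. (k y \<bullet> b) *\<^sub>R L (h y) b)" if "y \<in> T" for y
  proof -
    have "L (h y) (\<Sum>b\<in>Basis. (k y \<bullet> b) *\<^sub>R b) = (\<Sum>b\<in>Basis. (k y \<bullet> b) *\<^sub>R L (h y) b)"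
      using lin[OF that] by (simp add: linear_sum linear_cmul)
    then show ?thesis by (simp add: euclidean_representation)
  qed
  have "continuous_on T (\<lambda>y. L (h y) b)" if "b \<in> Basis" for b
    using continuous_on_compose2[OF cont[OF that] h(1)] h(2) by auto
  then have "continuous_on T (\<lambda>y. \<Sum>b\<in>Basis. (k y \<bullet> b) *\<^sub>R L (h y) b)"
    by (intro continuous_intros k)
  then show ?thesis
    using eq by (simp cong: continuous_on_cong)
qed

lemma Ck_on_1_compose:
  fixes f :: "'b::euclidean_space \<Rightarrow> 'c::real_normed_vector" and g :: "'a::real_normed_vector \<Rightarrow> 'b"
  assumes f: "Ck_on 1 f T" and g: "Ck_on 1 g S" and sub: "\<And>x. x \<in> S \<Longrightarrow> g x \<in> T"
  shows "Ck_on 1 (\<lambda>x. f (g x)) S"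
proof (rule Ck_on_1I)
  fix x assume x: "x \<in> S"
  show "((\<lambda>x. f (g x)) has_derivative
      (\<lambda>v. frechet_derivative f (at (g x)) (frechet_derivative g (at x) v))) (at x)"
    using has_derivative_compose[OF Ck_on_1_derivative[OF g x] Ck_on_1_derivative[OF f sub[OF x]]] .
next
  fix v
  show "continuous_on S (\<lambda>x. frechet_derivative f (at (g x)) (frechet_derivative g (at x) v))"
  proof (rule continuous_on_linear_family[where h = g and S = T])
    show "linear (frechet_derivative f (at (g y)))" if "y \<in> S" for y
      using Ck_on_1_derivative[OF f sub[OF that]] has_derivative_linear by blast
    show "continuous_on T (\<lambda>x. frechet_derivative f (at x) b)" for b
      by (rule Ck_on_1_continuous_derivative[OF f])
  qed (fact Ck_on_1_continuous[OF g] sub Ck_on_1_continuous_derivative[OF g])+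
qed

lemma Ck_on_1_const: "Ck_on 1 (\<lambda>x. c) S"
  by (rule Ck_on_1I[where f' = "\<lambda>x v. 0"]) auto

lemma Ck_on_1_add:
  assumes f: "Ck_on 1 f S" and g: "Ck_on 1 g S"
  shows "Ck_on 1 (\<lambda>x. f x + g x) S"
proof (rule Ck_on_1I)
  fix x assume x: "x \<in> S"
  show "((\<lambda>x. f x + g x) has_derivative
      (\<lambda>v. frechet_derivative f (at x) v + frechet_derivative g (at x) v)) (at x)"
    by (intro has_derivative_add Ck_on_1_derivative[OF f x] Ck_on_1_derivative[OF g x])
qed (intro continuous_intros Ck_on_1_continuous_derivative[OF f] Ck_on_1_continuous_derivative[OF g])

lemma Ck_on_1_sum:
  assumes "\<And>i. i \<in> I \<Longrightarrow> Ck_on 1 (f i) S"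
  shows "Ck_on 1 (\<lambda>x. \<Sum>i\<in>I. f i x) S"
proof (cases "finite I")
  case True
  then show ?thesis using assms
  proof (induction I)
    case (insert i I)
    then have "Ck_on 1 (\<lambda>x. f i x + (\<Sum>i\<in>I. f i x)) S"
      by (intro Ck_on_1_add) blast+
    then show ?case
      using insert.hyps by (simp del: Ck_on.simps One_nat_def)
  qed (simp only: sum.empty Ck_on_1_const)
qed (simp only: sum.infinite Ck_on_1_const simp_thms)

lemma Ck_on_1_bilinear:
  assumes p: "bounded_bilinear p" and f: "Ck_on 1 f S" and g: "Ck_on 1 g S"
  shows "Ck_on 1 (\<lambda>x. p (f x) (g x)) S"
proof (rule Ck_on_1I)
  fix x assume x: "x \<in> S"
  show "((\<lambda>x. p (f x) (g x)) has_derivative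
      (\<lambda>v. p (f x) (frechet_derivative g (at x) v) + p (frechet_derivative f (at x) v) (g x))) (at x)"
    by (rule bounded_bilinear.FDERIV[OF p Ck_on_1_derivative[OF f x] Ck_on_1_derivative[OF g x]])
qed (intro continuous_intros bounded_bilinear.continuous_on[OF p] Ck_on_1_continuous[OF f]
      Ck_on_1_continuous[OF g] Ck_on_1_continuous_derivative[OF f] Ck_on_1_continuous_derivative[OF g])

lemmas Ck_on_1_mult = Ck_on_1_bilinear[OF bounded_bilinear_mult]

lemma Ck_on_1_real:
  fixes f :: "real \<Rightarrow> real"
  assumes "\<And>x. (f has_real_derivative f' x) (at x)" "continuous_on UNIV f'"
  shows "Ck_on 1 f UNIV"
  by (rule Ck_on_1I[where f' = "\<lambda>x v. f' x * v"])
     (use assms in \<open>auto simp: has_field_derivative_def intro!: continuous_intros\<close>)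

lemma has_real_derivative_eventually_eq:
  assumes "(f has_real_derivative D) (at t)" "\<forall>\<^sub>F s in at t. f s = g s" "f t = g t"
  shows "(g has_real_derivative D) (at t)"
  using has_field_derivative_cong_eventually[OF assms(2,3)] assms(1) by blast

section \<open>Parameter integrals and the variational equation\<close>

lemma has_derivative_snd_slice:
  assumes "(H has_derivative H') (at (s, x))"
  shows "((\<lambda>x. H (s, x)) has_derivative (\<lambda>v. H' (0, v))) (at x)"
proof -
  have "((\<lambda>x. (s, x)) has_derivative (\<lambda>v. (0, v))) (at x)"
    by (intro has_derivative_Pair has_derivative_const has_derivative_ident)
  from has_derivative_compose[OF this assms] show ?thesis .
qed

lemma has_derivative_integral_parameter:
  fixes H :: "real \<times> 'a::euclidean_space \<Rightarrow> 'b::banach"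
  assumes H: "Ck_on 1 H W" and W: "{a..b} \<times> S \<subseteq> W" and S: "open S" "x \<in> S"
  shows "((\<lambda>x. integral {a..b} (\<lambda>s. H (s, x))) has_derivative
    (\<lambda>v. integral {a..b} (\<lambda>s. frechet_derivative H (at (s, x)) (0, v)))) (at x)"
proof -
  obtain r where r: "r > 0" "ball x r \<subseteq> S"
    using S open_contains_ball by blast
  have inW: "(s, y) \<in> W" if "s \<in> {a..b}" "y \<in> ball x r" for s y
    using that r W by blast
  define D where "D y s = Blinfun (\<lambda>v. frechet_derivative H (at (s, y)) (0, v))" for y s
  have slice: "((\<lambda>y. H (s, y)) has_derivative (\<lambda>v. frechet_derivative H (at (s, y)) (0, v))) (at y)"
    if "s \<in> {a..b}" "y \<in> ball x r" for s y
    by (rule has_derivative_snd_slice[OF Ck_on_1_derivative[OF H inW[OF that]]])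
  have D: "blinfun_apply (D y s) = (\<lambda>v. frechet_derivative H (at (s, y)) (0, v))"
    if "s \<in> {a..b}" "y \<in> ball x r" for s y
    unfolding D_def by (rule bounded_linear_Blinfun_apply[OF has_derivative_bounded_linear[OF slice[OF that]]])
  have contD: "continuous_on (ball x r \<times> cbox a b) (\<lambda>(y, s). D y s)"
  proof (rule continuous_on_blinfun_componentwise)
    fix i :: 'a
    have "continuous_on (ball x r \<times> cbox a b) (\<lambda>z. frechet_derivative H (at (snd z, fst z)) (0, i))"
      by (rule continuous_on_compose2[OF Ck_on_1_continuous_derivative[OF H]])
         (use inW in \<open>auto intro!: continuous_intros\<close>)
    then show "continuous_on (ball x r \<times> cbox a b) (\<lambda>z. blinfun_apply (case z of (y, s) \<Rightarrow> D y s) i)"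
      by (rule continuous_on_eq) (auto simp: D)
  qed
  have contH: "continuous_on (cbox a b) (\<lambda>s. H (s, y))" if "y \<in> ball x r" for y
    by (rule continuous_on_compose2[OF Ck_on_1_continuous[OF H]])
       (use inW that in \<open>auto intro!: continuous_intros\<close>)
  have xr: "x \<in> ball x r" using r by simp
  have "continuous_on (cbox a b) (\<lambda>s. case (x, s) of (y, s) \<Rightarrow> D y s)"
    by (rule continuous_on_compose2[OF contD continuous_on_Pair[OF continuous_on_const continuous_on_id]])
       (use xr in blast)
  then have contDx: "continuous_on (cbox a b) (D x)" by simp
  have "((\<lambda>y. integral (cbox a b) (\<lambda>s. H (s, y))) has_derivative integral (cbox a b) (D x)) (at x within ball x r)"
  proof (rule leibniz_rule[OF _ _ contD xr convex_ball])
    show "((\<lambda>y. H (s, y)) has_derivative blinfun_apply (D y s)) (at y within ball x r)"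
      if "y \<in> ball x r" "s \<in> cbox a b" for y s
      using slice D that by (simp add: has_derivative_at_withinI)
  qed (rule integrable_continuous[OF contH])
  moreover have "blinfun_apply (integral (cbox a b) (D x)) =
      (\<lambda>v. integral (cbox a b) (\<lambda>s. frechet_derivative H (at (s, x)) (0, v)))"
  proof
    fix v
    have "integral (cbox a b) (\<lambda>s. blinfun_apply (D x s) v) =
        integral (cbox a b) (\<lambda>s. frechet_derivative H (at (s, x)) (0, v))"
      by (rule integral_cong) (simp add: D[OF _ xr])
    then show "blinfun_apply (integral (cbox a b) (D x)) v =
        integral (cbox a b) (\<lambda>s. frechet_derivative H (at (s, x)) (0, v))"
      by (simp only: blinfun_apply_integral[OF integrable_continuous[OF contDx]])
  qed
  ultimately show ?thesis
    using at_within_open[OF xr open_ball] by (simp add: cbox_interval)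
qed

lemma Ck_on_1_integral_parameter:
  fixes H :: "real \<times> 'a::euclidean_space \<Rightarrow> 'b::banach"
  assumes H: "Ck_on 1 H W" and W: "{a..b} \<times> S \<subseteq> W" and S: "open S"
  shows "Ck_on 1 (\<lambda>x. integral {a..b} (\<lambda>s. H (s, x))) S"
proof (rule Ck_on_1I)
  fix v
  have "continuous_on (S \<times> cbox a b) (\<lambda>(x, s). frechet_derivative H (at (s, x)) (0, v))"
  proof -
    have "continuous_on (S \<times> cbox a b) (\<lambda>z. frechet_derivative H (at (snd z, fst z)) (0, v))"
      by (rule continuous_on_compose2[OF Ck_on_1_continuous_derivative[OF H]])
         (use W in \<open>auto intro!: continuous_intros\<close>)
    then show ?thesis by (simp add: case_prod_beta')
  qed
  from integral_continuous_on_param[OF this]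
  show "continuous_on S (\<lambda>x. integral {a..b} (\<lambda>s. frechet_derivative H (at (s, x)) (0, v)))"
    by (simp add: cbox_interval)
qed (rule has_derivative_integral_parameter[OF H W S])

text \<open>
  The first variation of a \<open>C\<^sup>1\<close> family of solutions solves the linearised equation. The mixed second
  derivative is only known to exist in one order, so the equation is integrated in time first and then
  differentiated in the initial value under the integral sign.
\<close>

lemma variational_equation:
  fixes f :: "real \<times> 'a::euclidean_space \<Rightarrow> 'a"
  assumes f: "Ck_on 1 f W" and W: "open W" "(t\<^sub>0, x\<^sub>0) \<in> W"
    and V: "Ck_on 1 V S" and fS: "\<And>z. z \<in> W \<Longrightarrow> f z \<in> S"
    and ode: "\<And>t x. (t, x) \<in> W \<Longrightarrow> ((\<lambda>s. f (s, x)) has_vector_derivative V (f (t, x))) (at t)"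
  shows "((\<lambda>t. frechet_derivative f (at (t, x\<^sub>0)) (0, v)) has_vector_derivative
    frechet_derivative V (at (f (t\<^sub>0, x\<^sub>0))) (frechet_derivative f (at (t\<^sub>0, x\<^sub>0)) (0, v))) (at t\<^sub>0)"
proof -
  obtain A B where AB: "open A" "open B" "t\<^sub>0 \<in> A" "x\<^sub>0 \<in> B" "A \<times> B \<subseteq> W"
    using W by (metis mem_Times_iff fst_conv snd_conv open_prod_elim)
  obtain \<tau> where \<tau>: "\<tau> > 0" "cball t\<^sub>0 \<tau> \<subseteq> A"
    using AB open_contains_cball by blast
  define a b where "a = t\<^sub>0 - \<tau>" and "b = t\<^sub>0 + \<tau>"
  have t0: "t\<^sub>0 \<in> {a<..<b}" using \<tau> by (auto simp: a_def b_def)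
  have inW: "(s, x) \<in> W" if "s \<in> {a..b}" "x \<in> B" for s x
    using that AB \<tau> by (auto simp: a_def b_def dist_real_def subset_iff)
  have Vf: "Ck_on 1 (\<lambda>z. V (f z)) W"
    by (rule Ck_on_1_compose[OF V f fS])
  let ?D = "\<lambda>t. frechet_derivative f (at (t, x\<^sub>0)) (0, v)"
  let ?G = "\<lambda>t. frechet_derivative (\<lambda>z. V (f z)) (at (t, x\<^sub>0)) (0, v)"
  have slice: "((\<lambda>x. f (t, x)) has_derivative (\<lambda>v. frechet_derivative f (at (t, x\<^sub>0)) (0, v))) (at x\<^sub>0)"
    if "t \<in> {a..b}" for t
    by (rule has_derivative_snd_slice[OF Ck_on_1_derivative[OF f inW[OF that AB(4)]]])
  have integrated: "?D t = ?D a + integral {a..t} ?G" if t: "t \<in> {a..b}" for t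
  proof -
    have ab: "a \<in> {a..b}" using t by auto
    have eq: "f (t, x) - f (a, x) = integral {a..t} (\<lambda>s. V (f (s, x)))" if x: "x \<in> B" for x
    proof -
      have "((\<lambda>s. V (f (s, x))) has_integral f (t, x) - f (a, x)) {a..t}"
        by (rule fundamental_theorem_of_calculus)
           (use t x in \<open>auto intro!: has_vector_derivative_at_within ode inW\<close>)
      then show ?thesis by (simp add: integral_unique)
    qed
    have "((\<lambda>x. integral {a..t} (\<lambda>s. V (f (s, x)))) has_derivative
        (\<lambda>v. integral {a..t} (\<lambda>s. frechet_derivative (\<lambda>z. V (f z)) (at (s, x\<^sub>0)) (0, v)))) (at x\<^sub>0)"
      by (rule has_derivative_integral_parameter[OF Vf _ AB(2,4)]) (use t in \<open>auto intro: inW\<close>)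
    then have "((\<lambda>x. f (t, x) - f (a, x)) has_derivative
        (\<lambda>v. integral {a..t} (\<lambda>s. frechet_derivative (\<lambda>z. V (f z)) (at (s, x\<^sub>0)) (0, v)))) (at x\<^sub>0)"
      by (rule has_derivative_transform_within_open[OF _ AB(2,4)]) (simp add: eq)
    from has_derivative_unique[OF this has_derivative_diff[OF slice[OF t] slice[OF ab]]]
    have "integral {a..t} ?G = ?D t - ?D a" by metis
    then show ?thesis by simp
  qed
  have "continuous_on {a..b} ?G"
    by (rule continuous_on_compose2[OF Ck_on_1_continuous_derivative[OF Vf]])
       (use inW AB in \<open>auto intro!: continuous_intros\<close>)
  from integral_has_vector_derivative[OF this, of t\<^sub>0]
  have "((\<lambda>t. integral {a..t} ?G) has_vector_derivative ?G t\<^sub>0) (at t\<^sub>0 within {a..b})"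
    using t0 by auto
  then have "((\<lambda>t. integral {a..t} ?G) has_vector_derivative ?G t\<^sub>0) (at t\<^sub>0)"
    using at_within_interior[of t\<^sub>0 "{a..b}"] t0 by (simp add: interior_atLeastAtMost_real)
  from has_vector_derivative_add[OF has_vector_derivative_const[of "?D a"] this]
  have "((\<lambda>t. ?D a + integral {a..t} ?G) has_vector_derivative ?G t\<^sub>0) (at t\<^sub>0)"
    by simp
  then have "(?D has_vector_derivative ?G t\<^sub>0) (at t\<^sub>0)"
    by (rule has_vector_derivative_transform_within_open[OF _ open_greaterThanLessThan t0])
       (rule integrated[symmetric], simp)
  moreover have "frechet_derivative (\<lambda>z. V (f z)) (at (t\<^sub>0, x\<^sub>0)) =
      (\<lambda>w. frechet_derivative V (at (f (t\<^sub>0, x\<^sub>0))) (frechet_derivative f (at (t\<^sub>0, x\<^sub>0)) w))"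
    using frechet_derivative_at[OF has_derivative_compose[OF Ck_on_1_derivative[OF f W(2)]
          Ck_on_1_derivative[OF V fS[OF W(2)]]]] by simp
  ultimately show ?thesis by simp
qed

section \<open>The triple product\<close>

unbundle cross3_syntax

definition triple :: "real^3 \<Rightarrow> real^3 \<Rightarrow> real^3 \<Rightarrow> real" where
  "triple u v w = u \<bullet> (v \<times> w)"

lemma bounded_bilinear_cross: "bounded_bilinear ((\<times>) :: real^3 \<Rightarrow> real^3 \<Rightarrow> real^3)"
  using bilinear_cross bilinear_conv_bounded_bilinear by blast

lemma triple_add:
  "triple (a + b) v w = triple a v w + triple b v w"
  "triple u (a + b) w = triple u a w + triple u b w"
  "triple u v (a + b) = triple u v a + triple u v b"
  by (simp_all add: triple_def inner_add_left inner_add_right cross_add_left cross_add_right)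

lemma triple_scale:
  "triple (r *\<^sub>R u) v w = r * triple u v w"
  "triple u (r *\<^sub>R v) w = r * triple u v w"
  "triple u v (r *\<^sub>R w) = r * triple u v w"
  by (simp_all add: triple_def cross_mult_left cross_mult_right)

lemma triple_alternating:
  "triple u u w = 0" "triple u v u = 0" "triple u w w = 0"
  by (simp_all add: triple_def dot_cross_self)

lemma triple_axis: "triple (axis 1 1) (axis 2 1) (axis 3 1) = 1"
  by (simp add: triple_def cross_basis inner_axis_axis)

lemma triple_linear_image:
  assumes "linear L"
  shows "triple (L u) (L v) (L w) = det (matrix L) * triple u v w"
proof -
  let ?M = "matrix L"
  have L: "L x = ?M *v x" for x
    using assms by (simp add: matrix_works)
  have "(?M *v u) \<bullet> y = u \<bullet> (transpose ?M *v y)" for y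
    by (simp only: transpose_matrix_vector inner_commute[of _ y] inner_commute[of u] dot_lmul_matrix)
  from this[of "(?M *v v) \<times> (?M *v w)"] show ?thesis
    by (simp add: triple_def L cross_matrix_mult del: transpose_matrix_vector)
qed

lemma det_matrix_triple:
  assumes "linear L"
  shows "det (matrix L) = triple (L (axis 1 1)) (L (axis 2 1)) (L (axis 3 1))"
  using triple_linear_image[OF assms, of "axis 1 1" "axis 2 1" "axis 3 1"] by (simp add: triple_axis)

lemma continuous_on_triple:
  assumes "continuous_on S u" "continuous_on S v" "continuous_on S w"
  shows "continuous_on S (\<lambda>x. triple (u x) (v x) (w x))"
  unfolding triple_def
  by (intro continuous_on_inner bounded_bilinear.continuous_on[OF bounded_bilinear_cross] assms)

lemma Ck_on_1_triple:
  assumes "Ck_on 1 u S" "Ck_on 1 v S" "Ck_on 1 w S"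
  shows "Ck_on 1 (\<lambda>x. triple (u x) (v x) (w x)) S"
  unfolding triple_def
  by (intro Ck_on_1_bilinear[OF bounded_bilinear_inner] Ck_on_1_bilinear[OF bounded_bilinear_cross] assms)

lemma has_real_derivative_triple:
  assumes "(u has_vector_derivative u') (at t)" "(v has_vector_derivative v') (at t)"
    and "(w has_vector_derivative w') (at t)"
  shows "((\<lambda>t. triple (u t) (v t) (w t)) has_real_derivative
    triple u' (v t) (w t) + triple (u t) v' (w t) + triple (u t) (v t) w') (at t)"
proof -
  have c: "((\<lambda>t. v t \<times> w t) has_vector_derivative v t \<times> w' + v' \<times> w t) (at t)"
    by (rule bounded_bilinear.has_vector_derivative[OF bounded_bilinear_cross assms(2,3)])
  show ?thesis
    using bounded_bilinear.has_vector_derivative[OF bounded_bilinear_inner assms(1) c]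
    by (simp add: has_real_derivative_iff_has_vector_derivative triple_def inner_add_right algebra_simps)
qed

text \<open>The linear map that sends the standard basis to the three vectors is injective, so its determinant is not zero.\<close>

lemma triple_nonzero:
  assumes "\<And>a b c. a *\<^sub>R u + b *\<^sub>R v + c *\<^sub>R w = 0 \<Longrightarrow> a = 0 \<and> b = 0 \<and> c = 0"
  shows "triple u v w \<noteq> 0"
proof -
  define L :: "real^3 \<Rightarrow> real^3" where "L x = x$1 *\<^sub>R u + x$2 *\<^sub>R v + x$3 *\<^sub>R w" for x
  have lin: "linear L"
    by (auto intro!: linearI simp: L_def algebra_simps)
  have "inj L"
    unfolding linear_injective_0[OF lin]
  proof (intro allI impI)
    fix x assume "L x = 0"
    then have "x$1 = 0 \<and> x$2 = 0 \<and> x$3 = 0"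
      using assms unfolding L_def by blast
    then show "x = 0"
      by (simp add: vec_eq_iff forall_3)
  qed
  then have "det (matrix L) \<noteq> 0"
    using det_nz_iff_inj[OF lin] by simp
  moreover have "L (axis 1 1) = u" "L (axis 2 1) = v" "L (axis 3 1) = w"
    by (simp_all add: L_def axis_def)
  ultimately show ?thesis
    using det_matrix_triple[OF lin] by simp
qed

unbundle no cross3_syntax

section \<open>Charts and transition maps\<close>

definition transition_diff :: "'m chart \<Rightarrow> 'm chart \<Rightarrow> 'm \<Rightarrow> real^3 \<Rightarrow> real^3" where
  "transition_diff c d p = frechet_derivative (cmap d \<circ> cinv c) (at (cmap c p))"

locale oriented_manifold =
  fixes A :: "('m::t2_space) chart set"
  assumes atlas: "oriented_smooth_atlas A"
begin

lemma ex_chart: "\<exists>c\<in>A. p \<in> cdom c"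
  using atlas by (auto simp: oriented_smooth_atlas_def)

lemma pchart: "pchart A p \<in> A" "p \<in> cdom (pchart A p)"
  using someI_ex[of "\<lambda>c. c \<in> A \<and> p \<in> cdom c"] ex_chart[of p] unfolding pchart_def by blast+

context
  fixes c assumes c: "c \<in> A"
begin

lemma open_cdom: "open (cdom c)" and open_cimg: "open (cimg c)"
  and chart_homeomorphism: "homeomorphism (cdom c) (cimg c) (cmap c) (cinv c)"
  using atlas c by (auto simp: oriented_smooth_atlas_def)

lemma cinv_cmap: "p \<in> cdom c \<Longrightarrow> cinv c (cmap c p) = p"
  and cmap_cinv: "x \<in> cimg c \<Longrightarrow> cmap c (cinv c x) = x"
  and cmap_in_cimg: "p \<in> cdom c \<Longrightarrow> cmap c p \<in> cimg c"
  and cinv_in_cdom: "x \<in> cimg c \<Longrightarrow> cinv c x \<in> cdom c"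
  and continuous_on_cmap: "continuous_on (cdom c) (cmap c)"
  and continuous_on_cinv: "continuous_on (cimg c) (cinv c)"
  using chart_homeomorphism by (auto simp: homeomorphism_def)

lemma cmap_image_eq: "cmap c ` (cdom c \<inter> U) = {x \<in> cimg c. cinv c x \<in> U}"
proof safe
  fix x assume "x \<in> cimg c" "cinv c x \<in> U"
  then show "x \<in> cmap c ` (cdom c \<inter> U)"
    using cmap_cinv cinv_in_cdom by (metis IntI image_eqI)
qed (simp_all add: cinv_cmap cmap_in_cimg)

lemma open_cmap_image: "open U \<Longrightarrow> open (cmap c ` (cdom c \<inter> U))"
  unfolding cmap_image_eq
  using continuous_open_preimage[OF continuous_on_cinv open_cimg, of U] by (simp add: Int_def vimage_def)

end

lemma transition_smooth:
  assumes "c \<in> A" "d \<in> A"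
  shows "Ck_on n (cmap d \<circ> cinv c) (cmap c ` (cdom c \<inter> cdom d))"
  using atlas assms unfolding oriented_smooth_atlas_def by blast

lemma has_derivative_transition:
  assumes "c \<in> A" "d \<in> A" "p \<in> cdom c" "p \<in> cdom d"
  shows "((\<lambda>x. cmap d (cinv c x)) has_derivative transition_diff c d p) (at (cmap c p))"
  using Ck_on_1_derivative[OF transition_smooth[OF assms(1,2)], of "cmap c p"] assms(3,4)
  by (auto simp: transition_diff_def o_def)

lemma linear_transition_diff:
  assumes "c \<in> A" "d \<in> A" "p \<in> cdom c" "p \<in> cdom d"
  shows "linear (transition_diff c d p)"
  using has_derivative_transition[OF assms] has_derivative_linear by blast

lemma has_derivative_chart_transform:
  assumes f: "(f has_derivative f') (at (cmap c p))" and c: "c \<in> A" "p \<in> cdom c" and U: "open U" "p \<in> U"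
    and eq: "\<And>q. q \<in> cdom c \<Longrightarrow> q \<in> U \<Longrightarrow> f (cmap c q) = h (cmap c q)"
  shows "(h has_derivative f') (at (cmap c p))"
  by (rule has_derivative_transform_within_open[OF f open_cmap_image[OF c(1) U(1)]]) (use c U eq in auto)

lemma transition_diff_compose:
  assumes "c \<in> A" "d \<in> A" "e \<in> A" "p \<in> cdom c" "p \<in> cdom d" "p \<in> cdom e"
  shows "transition_diff d e p (transition_diff c d p v) = transition_diff c e p v"
proof -
  have "((\<lambda>x. cmap e (cinv d (cmap d (cinv c x)))) has_derivative
      (\<lambda>v. transition_diff d e p (transition_diff c d p v))) (at (cmap c p))"
    using has_derivative_compose[OF has_derivative_transition[OF assms(1,2,4,5)],
        where g = "\<lambda>y. cmap e (cinv d y)"] has_derivative_transition[OF assms(2,3,5,6)]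
    by (simp add: cinv_cmap[OF assms(1,4)])
  then have "((\<lambda>x. cmap e (cinv c x)) has_derivative
      (\<lambda>v. transition_diff d e p (transition_diff c d p v))) (at (cmap c p))"
    by (rule has_derivative_chart_transform[OF _ assms(1,4) open_cdom[OF assms(2)] assms(5)])
       (simp add: cinv_cmap assms)
  from has_derivative_unique[OF this has_derivative_transition[OF assms(1,3,4,6)]] show ?thesis
    by (rule fun_cong)
qed

lemma transition_diff_self:
  assumes "c \<in> A" "p \<in> cdom c"
  shows "transition_diff c c p v = v"
proof -
  have "((\<lambda>x. cmap c (cinv c x)) has_derivative (\<lambda>v. v)) (at (cmap c p))"
    by (rule has_derivative_chart_transform[OF has_derivative_ident assms open_UNIV UNIV_I])
       (simp add: cinv_cmap assms)
  from has_derivative_unique[OF this has_derivative_transition[OF assms(1,1,2,2)]] show ?thesis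
    by metis
qed

lemma det_transition_diff_pos:
  assumes "c \<in> A" "d \<in> A" "p \<in> cdom c" "p \<in> cdom d"
  shows "det (matrix (transition_diff c d p)) > 0"
  using atlas assms unfolding oriented_smooth_atlas_def transition_diff_def by blast

lemma tcoord_eq: "tcoord A c p = transition_diff (pchart A p) c p"
  and tvec_eq: "tvec A c p = transition_diff c (pchart A p) p"
  by (simp_all add: tcoord_def tvec_def transition_diff_def)

lemma tcoord_tvec:
  assumes "c \<in> A" "d \<in> A" "p \<in> cdom c" "p \<in> cdom d"
  shows "tcoord A d p (tvec A c p v) = transition_diff c d p v"
  using assms pchart by (simp add: tcoord_eq tvec_eq transition_diff_compose)

lemma tvec_tcoord:
  assumes "c \<in> A" "p \<in> cdom c"
  shows "tvec A c p (tcoord A c p v) = v" "tcoord A c p (tvec A c p v) = v"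
  using assms pchart by (simp_all add: tcoord_eq tvec_eq transition_diff_compose transition_diff_self)

lemma
  assumes "c \<in> A" "p \<in> cdom c"
  shows linear_tcoord: "linear (tcoord A c p)" and linear_tvec: "linear (tvec A c p)"
    and det_tcoord_pos: "det (matrix (tcoord A c p)) > 0"
    and det_tvec_pos: "det (matrix (tvec A c p)) > 0"
  using assms pchart
  by (simp_all add: tcoord_eq tvec_eq linear_transition_diff det_transition_diff_pos)

lemma det_tcoord_tvec:
  assumes "c \<in> A" "d \<in> A" "p \<in> cdom c" "p \<in> cdom d"
  shows "det (matrix (tcoord A d p)) * det (matrix (tvec A c p)) = det (matrix (transition_diff c d p))"
  using triple_linear_image[OF linear_tcoord[OF assms(2,4)], of "tvec A c p (axis 1 1)" "tvec A c p (axis 2 1)"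
      "tvec A c p (axis 3 1)"]
  by (simp add: tcoord_tvec[OF assms] det_matrix_triple linear_transition_diff[OF assms]
      linear_tvec[OF assms(1,3)] linear_tcoord[OF assms(2,4)])

lemma det_tcoord_tvec_self:
  assumes "c \<in> A" "p \<in> cdom c"
  shows "det (matrix (tcoord A c p)) * det (matrix (tvec A c p)) = 1"
  using det_tcoord_tvec[OF assms(1,1,2,2)] assms
  by (simp add: det_matrix_triple linear_transition_diff transition_diff_self triple_axis)

lemma continuous_on_manifold_iff:
  fixes f :: "'m \<Rightarrow> 'b::topological_space"
  shows "continuous_on UNIV f \<longleftrightarrow> (\<forall>c\<in>A. continuous_on (cimg c) (\<lambda>x. f (cinv c x)))"
proof safe
  fix c assume "continuous_on UNIV f" "c \<in> A"
  then show "continuous_on (cimg c) (\<lambda>x. f (cinv c x))"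
    using continuous_on_compose2[OF _ continuous_on_cinv] by blast
next
  assume f: "\<forall>c\<in>A. continuous_on (cimg c) (\<lambda>x. f (cinv c x))"
  show "continuous_on UNIV f"
  proof (rule continuous_at_imp_continuous_on, rule ballI)
    fix p
    obtain c where c: "c \<in> A" "p \<in> cdom c" using ex_chart by blast
    have "continuous_on (cdom c) (\<lambda>q. f (cinv c (cmap c q)))"
      using continuous_on_compose2[OF f[rule_format, OF c(1)] continuous_on_cmap[OF c(1)]]
        cmap_in_cimg[OF c(1)] by blast
    then have "continuous_on (cdom c) f"
      by (rule continuous_on_eq) (simp add: cinv_cmap c(1))
    then show "isCont f p"
      using c open_cdom continuous_on_eq_continuous_at by blast
  qed
qed

section \<open>Functions and volume forms of class \<open>C\<^sup>1\<close>\<close>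

definition C1_function :: "('m \<Rightarrow> real) \<Rightarrow> bool" where
  "C1_function f \<longleftrightarrow> (\<forall>c\<in>A. Ck_on 1 (\<lambda>x. f (cinv c x)) (cimg c))"

lemma C1_function_continuous: "C1_function f \<Longrightarrow> continuous_on UNIV f"
  unfolding C1_function_def continuous_on_manifold_iff using Ck_on_1_continuous by blast

lemma C1_function_const: "C1_function (\<lambda>p. a)"
  and C1_function_add: "C1_function f \<Longrightarrow> C1_function h \<Longrightarrow> C1_function (\<lambda>p. f p + h p)"
  and C1_function_mult: "C1_function f \<Longrightarrow> C1_function h \<Longrightarrow> C1_function (\<lambda>p. f p * h p)"
  unfolding C1_function_def by (intro ballI Ck_on_1_const Ck_on_1_add Ck_on_1_mult; blast)+

text \<open>
  The open set \<open>U\<close> and the complement of \<open>K\<close> cover the manifold, and on the latter the function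
  vanishes identically.
\<close>

lemma Ck_on_1_extend_by_zero:
  fixes f :: "'m \<Rightarrow> real"
  assumes d: "d \<in> A" and U: "open U" and K: "closed K" "K \<subseteq> U" and zero: "\<And>q. q \<notin> K \<Longrightarrow> f q = 0"
    and C1: "Ck_on 1 (\<lambda>x. f (cinv d x)) (cmap d ` (cdom d \<inter> U))"
  shows "Ck_on 1 (\<lambda>x. f (cinv d x)) (cimg d)"
proof (rule Ck_on_1_locally)
  fix x assume x: "x \<in> cimg d"
  show "\<exists>V. open V \<and> x \<in> V \<and> Ck_on 1 (\<lambda>x. f (cinv d x)) V"
  proof (cases "cinv d x \<in> K")
    case True
    then have "x \<in> cmap d ` (cdom d \<inter> U)"
      using K x by (auto simp: cmap_image_eq[OF d])
    then show ?thesis using open_cmap_image[OF d U] C1 by blast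
  next
    case False
    let ?V = "cmap d ` (cdom d \<inter> - K)"
    have V: "open ?V" using open_cmap_image[OF d] K(1) by blast
    have "Ck_on 1 (\<lambda>x. f (cinv d x)) ?V"
      by (rule Ck_on_1_transform[OF Ck_on_1_const[of 0] V]) (auto simp: zero cinv_cmap[OF d])
    moreover have "x \<in> ?V" using x False by (auto simp: cmap_image_eq[OF d])
    ultimately show ?thesis using V by blast
  qed
qed

text \<open>
  The square vanishes to second order at \<open>0\<close>, so bump functions built from it join their zero set differentiably.
\<close>

lemma Ck_on_1_square_of_positive_part: "Ck_on 1 (\<lambda>s::real. (max 0 s)\<^sup>2) UNIV"
proof (rule Ck_on_1_real[where f' = "\<lambda>s. 2 * max 0 s"])
  fix s :: real
  \<comment> \<open>The error of the first-order expansion is at most quadratic, uniformly across the kink at \<open>0\<close>.\<close>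
  have bound: "\<bar>((max 0 y)\<^sup>2 - (max 0 s)\<^sup>2) / (y - s) - 2 * max 0 s\<bar> \<le> \<bar>y - s\<bar>" if "y \<noteq> s" for y
  proof -
    have "\<bar>(max 0 y)\<^sup>2 - (max 0 s)\<^sup>2 - 2 * max 0 s * (y - s)\<bar> \<le> (y - s)\<^sup>2"
    proof (cases "y > 0 \<and> s > 0")
      case True
      have "y\<^sup>2 - s\<^sup>2 - 2 * s * (y - s) = (y - s)\<^sup>2"
        by (simp add: power2_eq_square algebra_simps)
      then show ?thesis using True by (simp add: max_def)
    next
      case False
      then consider "y \<le> 0" "s \<le> 0" | "y \<le> 0" "s > 0" | "y > 0" "s \<le> 0" by linarith
      then show ?thesis
      proof cases
        case 2
        then have "s * y \<le> 0" by (simp add: mult_nonneg_nonpos)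
        moreover have "s * s \<ge> 0" by simp
        ultimately have "s * s - 2 * (s * y) \<ge> 0" by linarith
        then show ?thesis using 2 by (simp add: power2_eq_square algebra_simps)
      next
        case 3
        then have "y * s \<le> 0" by (simp add: mult_nonneg_nonpos)
        moreover have "s * s \<ge> 0" by simp
        ultimately have "2 * (y * s) \<le> s * s" by linarith
        then show ?thesis using 3 by (simp add: power2_eq_square algebra_simps)
      qed simp
    qed
    moreover have "((max 0 y)\<^sup>2 - (max 0 s)\<^sup>2) / (y - s) - 2 * max 0 s
        = ((max 0 y)\<^sup>2 - (max 0 s)\<^sup>2 - 2 * max 0 s * (y - s)) / (y - s)"
      using that by (simp add: field_simps)
    ultimately show ?thesis
      using that by (simp add: abs_divide divide_le_eq power2_eq_square abs_mult_self_eq)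
  qed
  have "((\<lambda>y. ((max 0 y)\<^sup>2 - (max 0 s)\<^sup>2) / (y - s) - 2 * max 0 s) \<longlongrightarrow> 0) (at s)"
  proof (rule Lim_null_comparison)
    show "\<forall>\<^sub>F y in at s. norm (((max 0 y)\<^sup>2 - (max 0 s)\<^sup>2) / (y - s) - 2 * max 0 s) \<le> \<bar>y - s\<bar>"
      using bound by (simp add: eventually_at_filter)
    show "((\<lambda>y. \<bar>y - s\<bar>) \<longlongrightarrow> 0) (at s)"
      by (auto intro!: tendsto_eq_intros)
  qed
  then show "((\<lambda>s. (max 0 s)\<^sup>2) has_real_derivative 2 * max 0 s) (at s)"
    unfolding has_field_derivative_iff by (simp only: LIM_zero_iff)
qed (intro continuous_intros)

lemma ex_bump_function:
  assumes c: "c \<in> A" and U: "open U" "U \<subseteq> cdom c" "p \<in> U"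
  obtains b K where "C1_function b" "closed K" "K \<subseteq> U" "\<And>q. b q \<ge> 0" "b p > 0" "\<And>q. q \<notin> K \<Longrightarrow> b q = 0"
proof -
  let ?x = "cmap c p"
  have p: "p \<in> cdom c" using U by blast
  have "open (cmap c ` (cdom c \<inter> U))" "?x \<in> cmap c ` (cdom c \<inter> U)"
    using open_cmap_image[OF c] U by blast+
  then obtain r where r: "r > 0" "cball ?x r \<subseteq> cmap c ` (cdom c \<inter> U)"
    using open_contains_cball by blast
  then have cb: "x \<in> cimg c \<and> cinv c x \<in> U" if "x \<in> cball ?x r" for x
    using that cmap_image_eq[OF c] by auto
  define \<beta> where "\<beta> x = (max 0 (r\<^sup>2 - (x - ?x) \<bullet> (x - ?x)))\<^sup>2" for x :: "real^3"
  have C1\<beta>: "Ck_on 1 \<beta> UNIV"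
  proof -
    have "Ck_on 1 (\<lambda>x. x - ?x) UNIV"
      by (rule Ck_on_1I[where f' = "\<lambda>x v. v"]) (auto intro!: derivative_eq_intros)
    then have "Ck_on 1 (\<lambda>x. r\<^sup>2 + (-1) * ((x - ?x) \<bullet> (x - ?x))) UNIV"
      by (intro Ck_on_1_add Ck_on_1_mult Ck_on_1_const Ck_on_1_bilinear[OF bounded_bilinear_inner])
    then have "Ck_on 1 (\<lambda>x. r\<^sup>2 - (x - ?x) \<bullet> (x - ?x)) UNIV"
      by (rule Ck_on_1_transform) auto
    from Ck_on_1_compose[OF Ck_on_1_square_of_positive_part this UNIV_I] show ?thesis
      unfolding \<beta>_def[abs_def] .
  qed
  have \<beta>0: "\<beta> x = 0" if "x \<notin> cball ?x r" for x
  proof -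
    have "r < norm (x - ?x)" using that by (simp add: dist_norm norm_minus_commute)
    then have "r\<^sup>2 < (norm (x - ?x))\<^sup>2" using r by (simp add: power_strict_mono)
    then show ?thesis by (simp add: \<beta>_def power2_norm_eq_inner)
  qed
  define b where "b q = (if q \<in> cdom c then \<beta> (cmap c q) else 0)" for q
  let ?K = "cinv c ` cball ?x r"
  have "compact ?K"
    by (rule compact_continuous_image[OF continuous_on_subset[OF continuous_on_cinv[OF c]]]) (use cb in auto)
  then have K: "closed ?K" by (rule compact_imp_closed)
  have KU: "?K \<subseteq> U" using cb by blast
  have zero: "b q = 0" if q: "q \<notin> ?K" for q
  proof (cases "q \<in> cdom c")
    case True
    then have "cmap c q \<notin> cball ?x r" using q cinv_cmap[OF c True] by (metis image_eqI)
    then show ?thesis using \<beta>0 by (simp add: b_def)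
  qed (simp add: b_def)
  have "C1_function b"
    unfolding C1_function_def
  proof
    fix d assume d: "d \<in> A"
    let ?V = "cmap d ` (cdom d \<inter> cdom c)"
    have "Ck_on 1 (\<lambda>x. \<beta> ((cmap c \<circ> cinv d) x)) ?V"
      by (rule Ck_on_1_compose[OF C1\<beta> transition_smooth[OF d c]]) simp
    then have "Ck_on 1 (\<lambda>x. b (cinv d x)) ?V"
      by (rule Ck_on_1_transform[OF _ open_cmap_image[OF d open_cdom[OF c]]])
         (auto simp: b_def cinv_cmap[OF d])
    from Ck_on_1_extend_by_zero[OF d open_cdom[OF c] K subset_trans[OF KU U(2)] zero this]
    show "Ck_on 1 (\<lambda>x. b (cinv d x)) (cimg d)" .
  qed
  moreover have "b q \<ge> 0" for q by (simp add: b_def \<beta>_def)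
  moreover have "b p > 0" using r p by (simp add: b_def \<beta>_def)
  ultimately show ?thesis by (rule that[OF _ K KU _ _ zero])
qed

text \<open>
  Every 3-form is \<open>vform F\<close> for some \<open>F\<close>; as the preferred charts jump from point to point, \<open>F\<close> itself
  has no regularity, but because transition maps preserve orientation its sign is meaningful.
\<close>

definition vform :: "('m \<Rightarrow> real) \<Rightarrow> 'm \<Rightarrow> real^3 \<Rightarrow> real^3 \<Rightarrow> real^3 \<Rightarrow> real" where
  "vform F p u v w = F p * triple u v w"

text \<open>
  In a chart the factor missing in \<open>F\<close> is the determinant of the change of coordinates to the preferred
  chart.  It is positive, so a positive \<open>F\<close> stands for a form that is positive in every chart.
\<close>

lemma vol_coeff_vform:
  assumes "c \<in> A" "x \<in> cimg c"
  shows "vol_coeff A c (vform F) x = F (cinv c x) * det (matrix (tvec A c (cinv c x)))"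
  using linear_tvec[OF assms(1) cinv_in_cdom[OF assms]]
  by (simp add: vol_coeff_def vform_def det_matrix_triple)

lemma volume_form_vform:
  assumes "\<And>p. F p > 0" "\<And>c. c \<in> A \<Longrightarrow> continuous_on (cimg c) (vol_coeff A c (vform F))"
  shows "volume_form A (vform F)"
proof -
  have "vform F p (axis 1 1) (axis 2 1) (axis 3 1) \<noteq> 0" for p
    using assms(1)[of p] by (simp add: vform_def triple_axis)
  moreover have "linear (\<lambda>u. vform F p u v w) \<and> linear (\<lambda>u. vform F p v u w) \<and> linear (\<lambda>u. vform F p v w u)"
    for p v w
    by (auto intro!: linearI simp: vform_def triple_add triple_scale algebra_simps)
  ultimately show ?thesis
    using assms(2) unfolding volume_form_def by (auto simp: vform_def[abs_def] triple_alternating)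
qed

end

locale closed_oriented_manifold = oriented_manifold A for A :: "('m::t2_space) chart set" +
  assumes compact_manifold: "compact (UNIV :: 'm set)"
begin

text \<open>
  On an oriented manifold the coordinate volume forms of all charts have the same sign, so that a sum
  of finitely many of them, cut off by bump functions, does not vanish wherever one bump is positive.
\<close>

lemma ex_C1_volume_density:
  obtains F where "\<And>p. F p > 0" "\<And>c. c \<in> A \<Longrightarrow> Ck_on 1 (vol_coeff A c (vform F)) (cimg c)"
proof -
  have "\<exists>b K. C1_function b \<and> closed K \<and> K \<subseteq> cdom (pchart A p) \<and> (\<forall>q. b q \<ge> 0) \<and> b p > 0 \<and> (\<forall>q. q \<notin> K \<longrightarrow> b q = 0)"
    for p
    using ex_bump_function[OF pchart(1) open_cdom[OF pchart(1)] subset_refl pchart(2), of p] by metis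
  then obtain b K where b: "\<And>p. C1_function (b p)" "\<And>p. closed (K p)" "\<And>p. K p \<subseteq> cdom (pchart A p)"
    "\<And>p q. b p q \<ge> 0" "\<And>p. b p p > 0" "\<And>p q. q \<notin> K p \<Longrightarrow> b p q = 0"
    by metis
  have op: "open {q. 0 < b p q}" for p
    using open_Collect_less[OF continuous_on_const C1_function_continuous[OF b(1)]] by blast
  have "UNIV \<subseteq> (\<Union>p\<in>UNIV. {q. 0 < b p q})" using b(5) by blast
  then obtain I where I: "finite I" "UNIV \<subseteq> (\<Union>p\<in>I. {q. 0 < b p q})"
    using compactE_image[OF compact_manifold, of UNIV "\<lambda>p. {q. 0 < b p q}"] op by metis
  define F where "F q = (\<Sum>p\<in>I. b p q * det (matrix (tcoord A (pchart A p) q)))" for q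
  have nonneg: "b p q * det (matrix (tcoord A (pchart A p) q)) \<ge> 0" for p q
  proof (cases "q \<in> K p")
    case True
    then show ?thesis using b(3,4) det_tcoord_pos[OF pchart(1)] by (simp add: less_imp_le subset_iff)
  qed (simp add: b(6))
  have F: "F q > 0" for q
  proof -
    obtain p where p: "p \<in> I" "0 < b p q" using I by blast
    then have "q \<in> cdom (pchart A p)" using b(3,6) by fastforce
    then have "0 < b p q * det (matrix (tcoord A (pchart A p) q))"
      using p det_tcoord_pos[OF pchart(1)] by simp
    then show ?thesis
      unfolding F_def
      by (intro sum_pos2[OF I(1) p(1), of "\<lambda>p. b p q * det (matrix (tcoord A (pchart A p) q))"] nonneg)
  qed
  have C1: "Ck_on 1 (vol_coeff A d (vform F)) (cimg d)" if d: "d \<in> A" for d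
  proof -
    define f where "f p q = b p q * det (matrix (transition_diff d (pchart A p) q))" for p q
    have f: "Ck_on 1 (\<lambda>x. f p (cinv d x)) (cimg d)" for p
    proof (rule Ck_on_1_extend_by_zero[OF d open_cdom[OF pchart(1)] b(2,3)])
      let ?c = "pchart A p" and ?V = "cmap d ` (cdom d \<inter> cdom (pchart A p))"
      let ?J = "\<lambda>x. frechet_derivative (cmap ?c \<circ> cinv d) (at x)"
      have V: "open ?V" by (rule open_cmap_image[OF d open_cdom[OF pchart(1)]])
      have J: "Ck_on 1 (\<lambda>x. ?J x v) ?V" for v
        using Ck_on_Suc_derivative[OF transition_smooth[OF d pchart(1)] V] .
      have "Ck_on 1 (\<lambda>x. b p (cinv d x)) ?V"
        using b(1)[of p] d Ck_on_1_subset[of _ "cimg d" ?V] unfolding C1_function_def cimg_def by blast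
      then have "Ck_on 1 (\<lambda>x. b p (cinv d x) * triple (?J x (axis 1 1)) (?J x (axis 2 1)) (?J x (axis 3 1))) ?V"
        by (intro Ck_on_1_mult Ck_on_1_triple J)
      then show "Ck_on 1 (\<lambda>x. f p (cinv d x)) ?V"
      proof (rule Ck_on_1_transform[OF _ V])
        fix x assume x: "x \<in> ?V"
        then have x: "x \<in> cimg d" "cinv d x \<in> cdom d" "cinv d x \<in> cdom ?c"
          using cmap_image_eq[OF d] cinv_in_cdom[OF d] by auto
        show "b p (cinv d x) * triple (?J x (axis 1 1)) (?J x (axis 2 1)) (?J x (axis 3 1)) = f p (cinv d x)"
          using det_matrix_triple[OF linear_transition_diff[OF d pchart(1) x(2,3)]] cmap_cinv[OF d x(1)]
          by (simp add: f_def transition_diff_def)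
      qed
    qed (simp add: f_def b(6))
    have "Ck_on 1 (\<lambda>x. \<Sum>p\<in>I. f p (cinv d x)) (cimg d)"
      by (rule Ck_on_1_sum[OF f])
    then show ?thesis
    proof (rule Ck_on_1_transform[OF _ open_cimg[OF d]])
      fix x assume x: "x \<in> cimg d"
      have "b p q * det (matrix (tcoord A (pchart A p) q)) * det (matrix (tvec A d q)) = f p q"
        if q: "q = cinv d x" for p q
      proof (cases "q \<in> K p")
        case True
        then show ?thesis
          using det_tcoord_tvec[OF d pchart(1), of q p] cinv_in_cdom[OF d x] b(3) q
          by (auto simp: f_def)
      qed (simp add: f_def b(6))
      then show "(\<Sum>p\<in>I. f p (cinv d x)) = vol_coeff A d (vform F) x"
        by (simp add: vol_coeff_vform[OF d x] F_def sum_distrib_right)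
    qed
  qed
  show ?thesis using that F C1 by blast
qed

text \<open>Bump functions separate points, so the Stone-Weierstrass theorem applies to the \<open>C\<^sup>1\<close> functions.\<close>

lemma C1_functions_dense:
  fixes f :: "'m \<Rightarrow> real"
  assumes "continuous_on UNIV f" "e > 0"
  obtains h where "C1_function h" "\<And>p. \<bar>f p - h p\<bar> < e"
proof -
  interpret function_ring_on "{h. C1_function h}" "UNIV :: 'm set"
  proof
    fix p q :: 'm assume "p \<noteq> q"
    let ?c = "pchart A p"
    have "open (cdom ?c - {q})" "cdom ?c - {q} \<subseteq> cdom ?c" "p \<in> cdom ?c - {q}"
      using open_cdom[OF pchart(1)] pchart(2) \<open>p \<noteq> q\<close> by auto
    from ex_bump_function[OF pchart(1) this]
    obtain b K where b: "C1_function b" "K \<subseteq> cdom ?c - {q}" "b p > 0" "\<And>q. q \<notin> K \<Longrightarrow> b q = 0"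
      by metis
    then have "b q = 0" by blast
    then show "\<exists>h\<in>{h. C1_function h}. h p \<noteq> h q"
      using b(1,3) by (intro bexI[of _ b]) auto
  qed (auto intro: compact_manifold C1_function_continuous C1_function_add C1_function_mult C1_function_const)
  show ?thesis using Stone_Weierstrass_basic[OF assms] that by auto
qed

end



section \<open>Flows\<close>

definition flow_diff :: "(real \<Rightarrow> 'm \<Rightarrow> 'm) \<Rightarrow> 'm chart \<Rightarrow> 'm chart \<Rightarrow> real \<Rightarrow> 'm \<Rightarrow> real^3 \<Rightarrow> real^3" where
  "flow_diff \<phi> c d t p = frechet_derivative (cmap d \<circ> \<phi> t \<circ> cinv c) (at (cmap c p))"

locale flow_on_manifold = closed_oriented_manifold A for A :: "('m::t2_space) chart set" +
  fixes X :: "'m \<Rightarrow> real^3" and \<phi> :: "real \<Rightarrow> 'm \<Rightarrow> 'm"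
  assumes C1_X: "\<And>c. c \<in> A \<Longrightarrow> Ck_on 1 (vf_in_chart A c X) (cimg c)"
    and flow: "flow_of A X \<phi>"
begin

lemma flow_zero: "\<phi> 0 p = p" and flow_add: "\<phi> (s + t) p = \<phi> s (\<phi> t p)"
  and flow_continuous: "continuous_on UNIV (\<lambda>(t, p). \<phi> t p)"
  using flow by (auto simp: flow_of_def)

lemma continuous_on_flow [continuous_intros]:
  assumes "continuous_on S f" "continuous_on S h"
  shows "continuous_on S (\<lambda>x. \<phi> (f x) (h x))"
  using continuous_on_compose2[OF flow_continuous continuous_on_Pair[OF assms]] by simp

lemma eventually_flow_in:
  assumes "open U" "\<phi> t p \<in> U"
  shows "\<forall>\<^sub>F s in at t. \<phi> s p \<in> U"
proof -
  have "continuous_on UNIV (\<lambda>s. \<phi> s p)" by (intro continuous_intros)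
  then have "((\<lambda>s. \<phi> s p) \<longlongrightarrow> \<phi> t p) (at t)" by (simp add: continuous_on_def)
  then show ?thesis using topological_tendstoD assms by blast
qed

definition flow_domain :: "'m chart \<Rightarrow> 'm chart \<Rightarrow> (real \<times> (real^3)) set" where
  "flow_domain c d = {(t, x). x \<in> cimg c \<and> \<phi> t (cinv c x) \<in> cdom d}"

definition flow_rep :: "'m chart \<Rightarrow> 'm chart \<Rightarrow> real \<times> (real^3) \<Rightarrow> real^3" where
  "flow_rep c d = (\<lambda>(t, x). cmap d (\<phi> t (cinv c x)))"

lemma flow_rep_C1: "c \<in> A \<Longrightarrow> d \<in> A \<Longrightarrow> Ck_on 1 (flow_rep c d) (flow_domain c d)"
  using flow unfolding flow_of_def flow_domain_def flow_rep_def by blast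

lemma open_flow_domain:
  assumes "c \<in> A" "d \<in> A"
  shows "open (flow_domain c d)"
proof -
  have "continuous_on (UNIV \<times> cimg c) (\<lambda>z. \<phi> (fst z) (cinv c (snd z)))"
    by (intro continuous_intros continuous_on_compose2[OF continuous_on_cinv[OF assms(1)]]) auto
  from continuous_open_preimage[OF this open_Times[OF open_UNIV open_cimg[OF assms(1)]] open_cdom[OF assms(2)]]
  have "open ((UNIV \<times> cimg c) \<inter> (\<lambda>z. \<phi> (fst z) (cinv c (snd z))) -` cdom d)" .
  also have "(UNIV \<times> cimg c) \<inter> (\<lambda>z. \<phi> (fst z) (cinv c (snd z))) -` cdom d = flow_domain c d"
    by (auto simp: flow_domain_def)
  finally show ?thesis .
qed

lemma flow_domain_cmap:
  assumes "c \<in> A" "p \<in> cdom c" "\<phi> t p \<in> cdom d"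
  shows "(t, cmap c p) \<in> flow_domain c d"
  using assms by (simp add: flow_domain_def cmap_in_cimg cinv_cmap)

lemma has_derivative_flow:
  assumes "c \<in> A" "d \<in> A" "p \<in> cdom c" "\<phi> t p \<in> cdom d"
  shows "((\<lambda>x. cmap d (\<phi> t (cinv c x))) has_derivative flow_diff \<phi> c d t p) (at (cmap c p))"
    and "flow_diff \<phi> c d t p v = frechet_derivative (flow_rep c d) (at (t, cmap c p)) (0, v)"
proof -
  have *: "((\<lambda>x. cmap d (\<phi> t (cinv c x))) has_derivative
      (\<lambda>v. frechet_derivative (flow_rep c d) (at (t, cmap c p)) (0, v))) (at (cmap c p))"
    using has_derivative_snd_slice[OF Ck_on_1_derivative[OF flow_rep_C1 flow_domain_cmap]] assms
    by (simp add: flow_rep_def)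
  have eq: "flow_diff \<phi> c d t p = (\<lambda>v. frechet_derivative (flow_rep c d) (at (t, cmap c p)) (0, v))"
    using frechet_derivative_at[OF *] by (simp add: flow_diff_def o_def)
  show "((\<lambda>x. cmap d (\<phi> t (cinv c x))) has_derivative flow_diff \<phi> c d t p) (at (cmap c p))"
    using * unfolding eq .
  show "flow_diff \<phi> c d t p v = frechet_derivative (flow_rep c d) (at (t, cmap c p)) (0, v)"
    unfolding eq ..
qed

lemma linear_flow_diff:
  assumes "c \<in> A" "d \<in> A" "p \<in> cdom c" "\<phi> t p \<in> cdom d"
  shows "linear (flow_diff \<phi> c d t p)"
  using has_derivative_flow(1)[OF assms] has_derivative_linear by blast

text \<open>
  The chain rule for the local representatives of the flow under a change of charts at both ends.
\<close>

lemma flow_diff_transition: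
  assumes "c \<in> A" "d \<in> A" "p \<in> cdom c" "\<phi> t p \<in> cdom d"
    and "c' \<in> A" "d' \<in> A" "p \<in> cdom c'" "\<phi> t p \<in> cdom d'"
  shows "transition_diff d d' (\<phi> t p) (flow_diff \<phi> c d t p (transition_diff c' c p v)) = flow_diff \<phi> c' d' t p v"
proof -
  have "((\<lambda>x. cmap d (\<phi> t (cinv c (cmap c (cinv c' x))))) has_derivative
      (\<lambda>v. flow_diff \<phi> c d t p (transition_diff c' c p v))) (at (cmap c' p))"
    using has_derivative_compose[OF has_derivative_transition[OF assms(5,1,7,3)],
        where g = "\<lambda>y. cmap d (\<phi> t (cinv c y))"] has_derivative_flow(1)[OF assms(1-4)]
    by (simp add: cinv_cmap[OF assms(5,7)])
  from has_derivative_compose[OF this, where g = "\<lambda>y. cmap d' (cinv d y)"]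
  have "((\<lambda>x. cmap d' (cinv d (cmap d (\<phi> t (cinv c (cmap c (cinv c' x))))))) has_derivative
      (\<lambda>v. transition_diff d d' (\<phi> t p) (flow_diff \<phi> c d t p (transition_diff c' c p v)))) (at (cmap c' p))"
    using has_derivative_transition[OF assms(2,6,4,8)] assms by (simp add: cinv_cmap)
  moreover have "open ({q. \<phi> t q \<in> cdom d} \<inter> cdom c)"
  proof -
    have "continuous_on UNIV (\<lambda>q. \<phi> t q)" by (intro continuous_intros)
    then show ?thesis
      using open_vimage[OF open_cdom[OF assms(2)]] open_cdom[OF assms(1)] by (auto simp: vimage_def)
  qed
  ultimately have "((\<lambda>x. cmap d' (\<phi> t (cinv c' x))) has_derivative
      (\<lambda>v. transition_diff d d' (\<phi> t p) (flow_diff \<phi> c d t p (transition_diff c' c p v)))) (at (cmap c' p))"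
    by (rule has_derivative_chart_transform[OF _ assms(5,7)]) (use assms in \<open>auto simp: cinv_cmap\<close>)
  from has_derivative_unique[OF this has_derivative_flow(1)[OF assms(5,6,7,8)]] show ?thesis
    by metis
qed

lemma differential_eq: "differential A (\<phi> t) p = flow_diff \<phi> (pchart A p) (pchart A (\<phi> t p)) t p"
  by (simp add: differential_def flow_diff_def)

lemma linear_differential: "linear (differential A (\<phi> t) p)"
  unfolding differential_eq by (intro linear_flow_diff pchart)

lemma tcoord_differential_tvec:
  assumes "c \<in> A" "d \<in> A" "p \<in> cdom c" "\<phi> t p \<in> cdom d"
  shows "tcoord A d (\<phi> t p) (differential A (\<phi> t) p (tvec A c p v)) = flow_diff \<phi> c d t p v"
  unfolding differential_eq tcoord_eq tvec_eq by (rule flow_diff_transition) (use assms pchart in auto)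

lemma tcoord_differential:
  assumes "c \<in> A" "d \<in> A" "p \<in> cdom c" "\<phi> t p \<in> cdom d"
  shows "tcoord A d (\<phi> t p) (differential A (\<phi> t) p v) = flow_diff \<phi> c d t p (tcoord A c p v)"
  using tcoord_differential_tvec[OF assms, of "tcoord A c p v"] tvec_tcoord(1)[OF assms(1,3)] by simp

lemma flow_diff_zero:
  assumes "c \<in> A" "p \<in> cdom c"
  shows "flow_diff \<phi> c c 0 p v = v"
proof -
  have "flow_diff \<phi> c c 0 p v = transition_diff c c p v"
    by (simp add: flow_diff_def transition_diff_def flow_zero o_def)
  then show ?thesis by (simp add: transition_diff_self[OF assms])
qed

lemma differential_zero: "differential A (\<phi> 0) p v = v"
  unfolding differential_eq flow_zero by (rule flow_diff_zero) (rule pchart)+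

lemma has_vector_derivative_flow:
  assumes c: "c \<in> A" "\<phi> t p \<in> cdom c"
  shows "((\<lambda>s. cmap c (\<phi> s p)) has_vector_derivative tcoord A c (\<phi> t p) (X (\<phi> t p))) (at t)"
proof -
  define q where "q = \<phi> t p"
  let ?d = "pchart A q"
  have q: "q \<in> cdom c" "q \<in> cdom ?d" using c pchart by (auto simp: q_def)
  have "((\<lambda>t. cmap ?d (\<phi> t q)) has_vector_derivative X q) (at 0)"
    using flow unfolding flow_of_def by blast
  then have D: "((\<lambda>t. cmap ?d (\<phi> t q)) has_derivative (\<lambda>s. s *\<^sub>R X q)) (at 0)"
    by (simp add: has_vector_derivative_def)
  have "((\<lambda>s. cmap c (cinv ?d (cmap ?d (\<phi> s q)))) has_derivative
      (\<lambda>s. transition_diff ?d c q (s *\<^sub>R X q))) (at 0)"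
    using has_derivative_compose[OF D, where g = "\<lambda>y. cmap c (cinv ?d y)"]
      has_derivative_transition[OF pchart(1) c(1) q(2,1)] by (simp add: flow_zero)
  then have "((\<lambda>s. cmap c (cinv ?d (cmap ?d (\<phi> s q)))) has_vector_derivative tcoord A c q (X q)) (at 0)"
    using linear_tcoord[OF c(1) q(1)] by (simp add: has_vector_derivative_def tcoord_eq linear_cmul)
  moreover have "open {s. \<phi> s q \<in> cdom ?d}"
  proof -
    have "continuous_on UNIV (\<lambda>s. \<phi> s q)" by (intro continuous_intros)
    then show ?thesis using open_vimage[OF open_cdom[OF pchart(1)]] by (auto simp: vimage_def)
  qed
  ultimately have "((\<lambda>s. cmap c (\<phi> s q)) has_vector_derivative tcoord A c q (X q)) (at 0)"
    by (rule has_vector_derivative_transform_within_open) (use q pchart in \<open>auto simp: flow_zero cinv_cmap\<close>)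
  then have D: "((\<lambda>s. cmap c (\<phi> s q)) has_vector_derivative tcoord A c q (X q)) (at (t + (-t)))"
    by simp
  have "((\<lambda>s. s + (-t)) has_vector_derivative 1) (at t)"
    by (auto intro!: derivative_eq_intros)
  from vector_diff_chain_at[OF this D]
  have "((\<lambda>s. cmap c (\<phi> (s + (-t)) q)) has_vector_derivative tcoord A c q (X q)) (at t)"
    by (simp add: o_def)
  moreover have "\<phi> (s + (-t)) q = \<phi> s p" for s
    using flow_add[of "s + (-t)" t p] by (simp add: q_def)
  ultimately show ?thesis by (simp add: q_def)
qed

text \<open>
  Moving along the orbit for a time \<open>s\<close> and then for the time \<open>t\<close> is the same in either order; the
  two sides are the derivatives in \<open>s\<close> at \<open>s = 0\<close> of these two curves.
\<close>

lemma differential_X: "differential A (\<phi> t) p (X p) = X (\<phi> t p)"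
proof -
  let ?c = "pchart A p" and ?d = "pchart A (\<phi> t p)"
  have id: "tcoord A (pchart A q) q v = v" for q v
    by (simp add: tcoord_eq transition_diff_self[OF pchart])
  have "\<phi> 0 p \<in> cdom ?c" using pchart by (simp add: flow_zero)
  from has_vector_derivative_flow[OF pchart(1) this]
  have D: "((\<lambda>s. cmap ?c (\<phi> s p)) has_derivative (\<lambda>s. s *\<^sub>R X p)) (at 0)"
    by (simp add: has_vector_derivative_def flow_zero id)
  have "((\<lambda>s. cmap ?d (\<phi> t (cinv ?c (cmap ?c (\<phi> s p))))) has_derivative
      (\<lambda>s. differential A (\<phi> t) p (s *\<^sub>R X p))) (at 0)"
    using has_derivative_compose[OF D, where g = "\<lambda>y. cmap ?d (\<phi> t (cinv ?c y))"]
      has_derivative_flow(1)[OF pchart(1,1,2,2)] by (simp add: flow_zero differential_eq)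
  then have "((\<lambda>s. cmap ?d (\<phi> t (cinv ?c (cmap ?c (\<phi> s p))))) has_vector_derivative
      differential A (\<phi> t) p (X p)) (at 0)"
    using linear_differential by (simp add: has_vector_derivative_def linear_cmul)
  moreover have "open {s. \<phi> s p \<in> cdom ?c}"
  proof -
    have "continuous_on UNIV (\<lambda>s. \<phi> s p)" by (intro continuous_intros)
    then show ?thesis using open_vimage[OF open_cdom[OF pchart(1)]] by (auto simp: vimage_def)
  qed
  ultimately have 1: "((\<lambda>s. cmap ?d (\<phi> t (\<phi> s p))) has_vector_derivative differential A (\<phi> t) p (X p)) (at 0)"
    by (rule has_vector_derivative_transform_within_open) (use pchart in \<open>auto simp: flow_zero cinv_cmap\<close>)
  have "\<phi> 0 (\<phi> t p) \<in> cdom ?d" using pchart by (simp add: flow_zero)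
  from has_vector_derivative_flow[OF pchart(1) this]
  have "((\<lambda>s. cmap ?d (\<phi> s (\<phi> t p))) has_vector_derivative X (\<phi> t p)) (at 0)"
    by (simp add: flow_zero id)
  moreover have "\<phi> s (\<phi> t p) = \<phi> t (\<phi> s p)" for s
    using flow_add[of s t p] flow_add[of t s p] by (simp add: add.commute)
  ultimately have "((\<lambda>s. cmap ?d (\<phi> t (\<phi> s p))) has_vector_derivative X (\<phi> t p)) (at 0)"
    by (simp only:)
  from vector_derivative_unique_at[OF 1 this] show ?thesis .
qed

section \<open>The Jacobian of the flow and the divergence\<close>

text \<open>
  The determinant is taken between the preferred charts of \<open>p\<close> and of \<open>\<phi> t p\<close>, and the latter may jump
  with \<open>t\<close>.  The jumps of \<open>F (\<phi> t p)\<close> for a volume form \<open>vform F\<close> compensate those of the Jacobian, so that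
  the product of the two is the quantity to be differentiated in \<open>t\<close>.
\<close>

definition jacobian :: "real \<Rightarrow> 'm \<Rightarrow> real" where
  "jacobian t p = det (matrix (differential A (\<phi> t) p))"

lemma triple_differential:
  "triple (differential A (\<phi> t) p u) (differential A (\<phi> t) p v) (differential A (\<phi> t) p w) =
    jacobian t p * triple u v w"
  unfolding jacobian_def by (rule triple_linear_image[OF linear_differential])

text \<open>
  Fixed charts at both ends turn the Jacobian into the determinant of a local representative of the
  flow, which is continuous in \<open>t\<close>.
\<close>

lemma jacobian_in_charts:
  assumes "c \<in> A" "d \<in> A" "p \<in> cdom c" "\<phi> t p \<in> cdom d"
  shows "det (matrix (tcoord A d (\<phi> t p))) * jacobian t p =
    triple (flow_diff \<phi> c d t p (axis 1 1)) (flow_diff \<phi> c d t p (axis 2 1)) (flow_diff \<phi> c d t p (axis 3 1))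
      * det (matrix (tcoord A c p))"
proof -
  let ?T = "\<lambda>L::real^3 \<Rightarrow> real^3. triple (L (axis 1 1)) (L (axis 2 1)) (L (axis 3 1))"
  have "det (matrix (tcoord A d (\<phi> t p))) * jacobian t p =
      ?T (\<lambda>v. tcoord A d (\<phi> t p) (differential A (\<phi> t) p v))"
    using triple_linear_image[OF linear_tcoord[OF assms(2,4)]] by (simp add: triple_differential triple_axis)
  also have "\<dots> = ?T (\<lambda>v. flow_diff \<phi> c d t p (tcoord A c p v))"
    by (simp add: tcoord_differential[OF assms])
  also have "\<dots> = ?T (flow_diff \<phi> c d t p) * det (matrix (tcoord A c p))"
    by (rule trans[OF triple_linear_image[OF linear_flow_diff[OF assms]]])
       (simp only: det_matrix_triple[OF linear_flow_diff[OF assms]] det_matrix_triple[OF linear_tcoord[OF assms(1,3)]])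
  finally show ?thesis .
qed

text \<open>
  This is the variational equation at time \<open>0\<close>, where the first variation is the identity.
\<close>

lemma flow_diff_has_vector_derivative:
  assumes c: "c \<in> A" "p \<in> cdom c"
  shows "((\<lambda>t. flow_diff \<phi> c c t p v) has_vector_derivative
    frechet_derivative (vf_in_chart A c X) (at (cmap c p)) v) (at 0)"
proof -
  let ?V = "vf_in_chart A c X" and ?x = "cmap c p"
  have 0: "(0, ?x) \<in> flow_domain c c"
    by (rule flow_domain_cmap) (use c in \<open>auto simp: flow_zero\<close>)
  have ode: "((\<lambda>s. flow_rep c c (s, x)) has_vector_derivative ?V (flow_rep c c (t, x))) (at t)"
    if "(t, x) \<in> flow_domain c c" for t x
    using has_vector_derivative_flow[OF c(1), of t "cinv c x"] that
    by (simp add: flow_domain_def flow_rep_def vf_in_chart_def cinv_cmap[OF c(1)])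
  have val: "flow_rep c c (0, ?x) = ?x"
    by (simp add: flow_rep_def flow_zero cinv_cmap c)
  have "frechet_derivative (flow_rep c c) (at (0, ?x)) (0, v) = v"
    using has_derivative_flow(2)[OF c(1,1,2), of 0 v] flow_diff_zero[OF c] c by (simp add: flow_zero)
  moreover have "((\<lambda>t. frechet_derivative (flow_rep c c) (at (t, ?x)) (0, v)) has_vector_derivative
      frechet_derivative ?V (at (flow_rep c c (0, ?x))) (frechet_derivative (flow_rep c c) (at (0, ?x)) (0, v))) (at 0)"
    by (rule variational_equation[OF flow_rep_C1[OF c(1,1)] open_flow_domain[OF c(1,1)] 0 C1_X[OF c(1)] _ ode])
       (auto simp: flow_domain_def flow_rep_def cmap_in_cimg[OF c(1)])
  ultimately have "((\<lambda>t. frechet_derivative (flow_rep c c) (at (t, ?x)) (0, v)) has_vector_derivative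
      frechet_derivative ?V (at ?x) v) (at 0)"
    by (simp add: val)
  moreover have "open {t. \<phi> t p \<in> cdom c}"
  proof -
    have "continuous_on UNIV (\<lambda>s. \<phi> s p)" by (intro continuous_intros)
    then show ?thesis using open_vimage[OF open_cdom[OF c(1)]] by (auto simp: vimage_def)
  qed
  ultimately show ?thesis
    by (rule has_vector_derivative_transform_within_open)
       (use c in \<open>auto simp: flow_zero has_derivative_flow(2)\<close>)
qed

text \<open>
  This is the trace of the derivative of \<open>X\<close> in the chart \<open>c\<close>, in the form in which it arises as the derivative
  of a determinant at the identity.
\<close>

definition chart_divergence :: "'m chart \<Rightarrow> real^3 \<Rightarrow> real" where
  "chart_divergence c x =
    (let D = frechet_derivative (vf_in_chart A c X) (at x)
     in triple (D (axis 1 1)) (axis 2 1) (axis 3 1) + triple (axis 1 1) (D (axis 2 1)) (axis 3 1)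
      + triple (axis 1 1) (axis 2 1) (D (axis 3 1)))"

lemma det_flow_diff_has_derivative:
  assumes c: "c \<in> A" "p \<in> cdom c"
  shows "((\<lambda>t. triple (flow_diff \<phi> c c t p (axis 1 1)) (flow_diff \<phi> c c t p (axis 2 1))
    (flow_diff \<phi> c c t p (axis 3 1))) has_real_derivative chart_divergence c (cmap c p)) (at 0)"
  using has_real_derivative_triple[OF flow_diff_has_vector_derivative[OF c] flow_diff_has_vector_derivative[OF c]
      flow_diff_has_vector_derivative[OF c], of "axis 1 1" "axis 2 1" "axis 3 1"]
  by (simp add: flow_diff_zero[OF c] chart_divergence_def Let_def)

lemma jacobian_zero: "jacobian 0 p = 1"
  using triple_differential[of 0 p "axis 1 1" "axis 2 1" "axis 3 1"] by (simp add: differential_zero triple_axis)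

text \<open>
  The determinant in a fixed chart is continuous and equals \<open>1\<close> at time \<open>0\<close>; the changes of coordinates
  to the preferred charts preserve orientation.
\<close>

lemma eventually_jacobian_pos: "\<forall>\<^sub>F t in at 0. jacobian t p > 0"
proof -
  let ?c = "pchart A p"
  let ?J = "\<lambda>t. triple (flow_diff \<phi> ?c ?c t p (axis 1 1)) (flow_diff \<phi> ?c ?c t p (axis 2 1))
    (flow_diff \<phi> ?c ?c t p (axis 3 1))"
  have "isCont ?J 0" using DERIV_isCont[OF det_flow_diff_has_derivative[OF pchart]] .
  moreover have "?J 0 = 1" by (simp add: flow_diff_zero[OF pchart] triple_axis)
  ultimately have "(?J \<longlongrightarrow> 1) (at 0)" by (simp add: isCont_def)
  then have "\<forall>\<^sub>F t in at 0. ?J t > 0" by (rule order_tendstoD) simp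
  moreover have "\<forall>\<^sub>F t in at 0. \<phi> t p \<in> cdom ?c"
    by (rule eventually_flow_in) (use pchart open_cdom in \<open>auto simp: flow_zero\<close>)
  ultimately show ?thesis
  proof eventually_elim
    case (elim t)
    have "det (matrix (tcoord A ?c (\<phi> t p))) * jacobian t p > 0"
      using jacobian_in_charts[OF pchart(1,1,2) elim(2)] elim(1) det_tcoord_pos[OF pchart] by simp
    then show ?case
      using det_tcoord_pos[OF pchart(1) elim(2)] by (simp add: zero_less_mult_iff)
  qed
qed

text \<open>
  Pulling back \<open>vform F\<close> by the flow multiplies it by a scalar, so that the divergence is determined
  by the derivative of a real function.
\<close>

lemma has_divergence_vform_iff:
  "has_divergence A \<phi> (vform F) \<delta> \<longleftrightarrow>
    (\<forall>p. ((\<lambda>t. F (\<phi> t p) * jacobian t p) has_real_derivative \<delta> p * F p) (at 0))"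
proof
  assume "has_divergence A \<phi> (vform F) \<delta>"
  then have *: "((\<lambda>t. F (\<phi> t p) * (jacobian t p * triple u v w)) has_real_derivative \<delta> p * (F p * triple u v w)) (at 0)"
    for p u v w
    by (simp add: has_divergence_def has_lie_derivative_def vform_def triple_differential)
  show "\<forall>p. ((\<lambda>t. F (\<phi> t p) * jacobian t p) has_real_derivative \<delta> p * F p) (at 0)"
    using *[of _ "axis 1 1" "axis 2 1" "axis 3 1"] by (simp add: triple_axis)
next
  assume "\<forall>p. ((\<lambda>t. F (\<phi> t p) * jacobian t p) has_real_derivative \<delta> p * F p) (at 0)"
  then have "((\<lambda>t. (F (\<phi> t p) * jacobian t p) * triple u v w) has_real_derivative (\<delta> p * F p) * triple u v w) (at 0)"
    for p u v w
    by (intro DERIV_cmult_right) blast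
  then show "has_divergence A \<phi> (vform F) \<delta>"
    by (simp add: has_divergence_def has_lie_derivative_def vform_def triple_differential mult.assoc)
qed

text \<open>
  If \<open>a\<close> is the coefficient in a chart, the pullback has the coefficient \<open>a (\<phi>\<^sup>t x) det (D\<phi>\<^sup>t x)\<close>, whose
  derivative at \<open>t = 0\<close> is \<open>X a + a tr (DX)\<close>.  So the divergence is \<open>X a / a + tr (DX)\<close> in this chart.
  Derivatives being unique, the expressions for different charts agree, which gives continuity.
\<close>

lemma C1_volume_density_has_divergence:
  assumes F: "\<And>p. F p > 0" "\<And>c. c \<in> A \<Longrightarrow> Ck_on 1 (vol_coeff A c (vform F)) (cimg c)"
  obtains \<delta> where "continuous_on UNIV \<delta>" "has_divergence A \<phi> (vform F) \<delta>"
proof -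
  define a where "a c = vol_coeff A c (vform F)" for c
  define V where "V c = vf_in_chart A c X" for c
  define \<delta>' where "\<delta>' c x = (frechet_derivative (a c) (at x) (V c x) + a c x * chart_divergence c x) / a c x" for c x
  define \<delta> where "\<delta> p = \<delta>' (pchart A p) (cmap (pchart A p) p)" for p
  have F_coeff: "F q = a c (cmap c q) * det (matrix (tcoord A c q))" if "c \<in> A" "q \<in> cdom c" for c q
    using vol_coeff_vform[OF that(1) cmap_in_cimg[OF that]] det_tcoord_tvec_self[OF that]
    by (simp add: a_def cinv_cmap[OF that] mult.assoc mult.commute[of "det (matrix (tvec A c q))"])
  have a_pos: "a c x > 0" if "c \<in> A" "x \<in> cimg c" for c x
    using vol_coeff_vform[OF that] F(1) det_tvec_pos[OF that(1) cinv_in_cdom[OF that]] by (simp add: a_def)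
  have deriv: "((\<lambda>t. F (\<phi> t p) * jacobian t p) has_real_derivative \<delta>' c (cmap c p) * F p) (at 0)"
    if c: "c \<in> A" "p \<in> cdom c" for c p
  proof -
    let ?x = "cmap c p"
    have x: "?x \<in> cimg c" by (rule cmap_in_cimg[OF c])
    let ?J = "\<lambda>t. triple (flow_diff \<phi> c c t p (axis 1 1)) (flow_diff \<phi> c c t p (axis 2 1))
      (flow_diff \<phi> c c t p (axis 3 1))"
    have \<phi>0: "\<phi> 0 p \<in> cdom c" using c by (simp add: flow_zero)
    have "((\<lambda>t. cmap c (\<phi> t p)) has_derivative (\<lambda>s. s *\<^sub>R V c ?x)) (at 0)"
      using has_vector_derivative_flow[OF c(1) \<phi>0]
      by (simp add: has_vector_derivative_def flow_zero V_def vf_in_chart_def cinv_cmap[OF c])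
    from has_derivative_compose[OF this, of "a c"]
    have "((\<lambda>t. a c (cmap c (\<phi> t p))) has_derivative
        (\<lambda>s. frechet_derivative (a c) (at ?x) (s *\<^sub>R V c ?x))) (at 0)"
      using Ck_on_1_derivative[OF F(2)[OF c(1)] x] by (simp add: flow_zero a_def)
    moreover have "linear (frechet_derivative (a c) (at ?x))"
      using Ck_on_1_derivative[OF F(2)[OF c(1)] x] has_derivative_linear unfolding a_def by blast
    ultimately have "((\<lambda>t. a c (cmap c (\<phi> t p))) has_real_derivative
        frechet_derivative (a c) (at ?x) (V c ?x)) (at 0)"
      by (simp add: has_real_derivative_iff_has_vector_derivative has_vector_derivative_def linear_cmul)
    from DERIV_cmult_right[OF DERIV_mult[OF this det_flow_diff_has_derivative[OF c]], of "det (matrix (tcoord A c p))"]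
    have "((\<lambda>t. a c (cmap c (\<phi> t p)) * ?J t * det (matrix (tcoord A c p))) has_real_derivative
        (frechet_derivative (a c) (at ?x) (V c ?x) + a c ?x * chart_divergence c ?x) * det (matrix (tcoord A c p))) (at 0)"
      by (simp add: flow_diff_zero[OF c] flow_zero triple_axis mult.commute)
    also have "(frechet_derivative (a c) (at ?x) (V c ?x) + a c ?x * chart_divergence c ?x) * det (matrix (tcoord A c p))
        = \<delta>' c ?x * F p"
      using a_pos[OF c(1) x] by (simp add: \<delta>'_def F_coeff[OF c])
    finally have D: "((\<lambda>t. a c (cmap c (\<phi> t p)) * ?J t * det (matrix (tcoord A c p))) has_real_derivative
        \<delta>' c ?x * F p) (at 0)" .
    show ?thesis
    proof (rule has_real_derivative_eventually_eq[OF D])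
      show "\<forall>\<^sub>F t in at 0. a c (cmap c (\<phi> t p)) * ?J t * det (matrix (tcoord A c p)) = F (\<phi> t p) * jacobian t p"
      using eventually_flow_in[OF open_cdom[OF c(1)] \<phi>0]
    proof eventually_elim
      case (elim t)
      then show ?case
        using jacobian_in_charts[OF c(1,1,2) elim] by (simp add: F_coeff[OF c(1) elim] mult.assoc)
    qed
      show "a c (cmap c (\<phi> 0 p)) * ?J 0 * det (matrix (tcoord A c p)) = F (\<phi> 0 p) * jacobian 0 p"
      by (simp add: flow_zero flow_diff_zero[OF c] triple_axis jacobian_zero F_coeff[OF c])
    qed
  qed
  have \<delta>: "\<delta> p = \<delta>' c (cmap c p)" if c: "c \<in> A" "p \<in> cdom c" for c p
    using DERIV_unique[OF deriv[OF c] deriv[OF pchart]] F(1)[of p] by (simp add: \<delta>_def)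
  have "continuous_on UNIV \<delta>"
    unfolding continuous_on_manifold_iff
  proof
    fix c assume c: "c \<in> A"
    have V: "continuous_on (cimg c) (V c)" and V': "continuous_on (cimg c) (\<lambda>x. frechet_derivative (V c) (at x) v)" for v
      using Ck_on_1_continuous[OF C1_X[OF c]] Ck_on_1_continuous_derivative[OF C1_X[OF c]] by (simp_all add: V_def)
    have "continuous_on (cimg c) (chart_divergence c)"
      using V' unfolding chart_divergence_def[abs_def] Let_def V_def
      by (intro continuous_intros continuous_on_triple) blast+
    moreover have "continuous_on (cimg c) (\<lambda>x. frechet_derivative (a c) (at x) (V c x))"
    proof (rule continuous_on_linear_family[where h = "\<lambda>x. x" and k = "V c" and S = "cimg c"
          and L = "\<lambda>x. frechet_derivative (a c) (at x)"])
      show "linear (frechet_derivative (a c) (at y))" if "y \<in> cimg c" for y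
        using Ck_on_1_derivative[OF F(2)[OF c] that] has_derivative_linear unfolding a_def by blast
      show "continuous_on (cimg c) (\<lambda>x. frechet_derivative (a c) (at x) v)" for v
        using Ck_on_1_continuous_derivative[OF F(2)[OF c]] by (simp add: a_def)
    qed (use V in auto)
    moreover have "continuous_on (cimg c) (a c)"
      using Ck_on_1_continuous[OF F(2)[OF c]] by (simp add: a_def)
    ultimately have "continuous_on (cimg c) (\<delta>' c)"
      unfolding \<delta>'_def[abs_def] using a_pos[OF c] by (intro continuous_intros) (auto simp: less_imp_neq[symmetric])
    then show "continuous_on (cimg c) (\<lambda>x. \<delta> (cinv c x))"
      by (rule continuous_on_eq) (simp add: \<delta>[OF c cinv_in_cdom[OF c]] cmap_cinv[OF c])
  qed
  moreover have "has_divergence A \<phi> (vform F) \<delta>"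
    unfolding has_divergence_vform_iff using deriv[OF pchart] by (simp add: \<delta>_def)
  ultimately show ?thesis by (rule that)
qed

section \<open>Averaging along the flow\<close>

lemma C1_function_flow_average:
  assumes h: "C1_function h"
  shows "C1_function (\<lambda>p. integral {0..T} (\<lambda>s. h (\<phi> s p)))"
  unfolding C1_function_def
proof
  fix c assume c: "c \<in> A"
  have "Ck_on 1 (\<lambda>(s, x). h (\<phi> s (cinv c x))) (UNIV \<times> cimg c)"
  proof (rule Ck_on_1_locally)
    fix z :: "real \<times> (real^3)" assume z: "z \<in> UNIV \<times> cimg c"
    obtain s x where sx: "z = (s, x)" by (cases z)
    let ?d = "pchart A (\<phi> s (cinv c x))"
    have d: "?d \<in> A" "\<phi> s (cinv c x) \<in> cdom ?d" by (rule pchart)+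
    have W: "open (flow_domain c ?d)" by (rule open_flow_domain[OF c d(1)])
    have "Ck_on 1 (\<lambda>x. h (cinv ?d x)) (cimg ?d)" using h d(1) by (simp only: C1_function_def)
    then have "Ck_on 1 (\<lambda>z. h (cinv ?d (flow_rep c ?d z))) (flow_domain c ?d)"
      by (rule Ck_on_1_compose[OF _ flow_rep_C1[OF c d(1)]])
         (auto simp: flow_domain_def flow_rep_def intro: cmap_in_cimg[OF d(1)])
    then have "Ck_on 1 (\<lambda>(s, x). h (\<phi> s (cinv c x))) (flow_domain c ?d)"
      by (rule Ck_on_1_transform[OF _ W]) (auto simp: flow_domain_def flow_rep_def cinv_cmap[OF d(1)])
    moreover have "z \<in> flow_domain c ?d" using z d by (simp add: sx flow_domain_def)
    ultimately show "\<exists>U. open U \<and> z \<in> U \<and> Ck_on 1 (\<lambda>(s, x). h (\<phi> s (cinv c x))) U"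
      using W by blast
  qed
  from Ck_on_1_integral_parameter[OF this _ open_cimg[OF c], of 0 T]
  show "Ck_on 1 (\<lambda>x. integral {0..T} (\<lambda>s. h (\<phi> s (cinv c x)))) (cimg c)"
    by (simp del: Ck_on.simps One_nat_def add: Sigma_mono)
qed

text \<open>
  Following the flow for a time \<open>t\<close> shifts the window of integration to \<open>[t, T + t]\<close>, so only its two ends
  contribute to the derivative.
\<close>

lemma flow_average_has_derivative:
  assumes h: "continuous_on UNIV h" and T: "T \<ge> 0"
  shows "((\<lambda>t. integral {0..T} (\<lambda>s. h (\<phi> s (\<phi> t p)))) has_real_derivative h (\<phi> T p) - h p) (at 0)"
proof -
  let ?k = "\<lambda>s. h (\<phi> s p)"
  \<comment> \<open>The margin of length \<open>1\<close> on both sides leaves room for shifting the window by \<open>t\<close> with \<open>\<bar>t\<bar> < 1\<close>.\<close>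
  have "continuous_on {-1..T+1} ?k"
    by (intro continuous_on_compose2[OF h] continuous_intros) auto
  then obtain G where G: "\<And>u. u \<in> {-1..T+1} \<Longrightarrow> (G has_vector_derivative ?k u) (at u within {-1..T+1})"
    using antiderivative_continuous by blast
  have G: "(G has_vector_derivative ?k u) (at u)" if "-1 < u" "u < T + 1" for u
    using G[of u] at_within_interior[of u "{-1..T+1}"] that by (simp add: interior_atLeastAtMost_real)
  have "integral {0..T} (\<lambda>s. h (\<phi> s (\<phi> t p))) = G (T + t) - G t" if t: "t \<in> {-1<..<1}" for t
  proof -
    have "((\<lambda>s. ?k (s + t)) has_integral G (T + t) - G (0 + t)) {0..T}"
    proof (rule fundamental_theorem_of_calculus[OF T])
      fix s assume s: "s \<in> {0..T}"
      have "((\<lambda>s. s + t) has_vector_derivative 1) (at s)"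
        by (auto intro!: derivative_eq_intros)
      from vector_diff_chain_at[OF this G] s t
      show "((\<lambda>s. G (s + t)) has_vector_derivative ?k (s + t)) (at s within {0..T})"
        by (simp add: o_def has_vector_derivative_at_within)
    qed
    then show ?thesis by (simp add: flow_add integral_unique)
  qed
  moreover have "((\<lambda>t. G (T + t) - G t) has_real_derivative h (\<phi> T p) - h p) (at 0)"
  proof -
    have "((\<lambda>t. T + t) has_vector_derivative 1) (at 0)"
      by (auto intro!: derivative_eq_intros)
    from vector_diff_chain_at[OF this G] T
    have "((\<lambda>t. G (T + t)) has_vector_derivative h (\<phi> T p)) (at 0)"
      by (simp add: o_def)
    from has_vector_derivative_diff[OF this G[of 0]] T show ?thesis
      by (simp add: flow_zero has_real_derivative_iff_has_vector_derivative)
  qed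
  ultimately show ?thesis
    by (subst DERIV_cong_ev[OF refl _ refl, where g = "\<lambda>t. G (T + t) - G t"])
       (auto simp: eventually_nhds intro!: exI[of _ "{-1<..<1}"])
qed

text \<open>
  The form is \<open>exp h \<Omega>\<^sub>0\<close> for a \<open>C\<^sup>1\<close> volume form \<open>\<Omega>\<^sub>0\<close> and a time average \<open>h\<close> of a \<open>C\<^sup>1\<close> approximation of
  \<open>h\<^sub>0 = ln (\<Omega> / \<Omega>\<^sub>0)\<close>.  The length \<open>T\<close> of the average is chosen before the accuracy of the approximation,
  since the difference quotient divides the error by \<open>T\<close>.
\<close>

lemma C1_volume_form_with_nearby_divergence:
  assumes F: "\<And>p. F p > 0" "\<And>c. c \<in> A \<Longrightarrow> continuous_on (cimg c) (vol_coeff A c (vform F))"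
    and div: "has_divergence A \<phi> (vform F) \<delta>" and \<delta>: "continuous_on UNIV \<delta>" and \<epsilon>: "\<epsilon> > 0"
  obtains \<Omega> \<delta>' where "C1_volume_form A \<Omega>" "has_divergence A \<phi> \<Omega> \<delta>'" "\<And>p. \<bar>\<delta>' p - \<delta> p\<bar> < \<epsilon>"
proof -
  obtain F\<^sub>0 where F0: "\<And>p. F\<^sub>0 p > 0" "\<And>c. c \<in> A \<Longrightarrow> Ck_on 1 (vol_coeff A c (vform F\<^sub>0)) (cimg c)"
    using ex_C1_volume_density by metis
  obtain \<delta>\<^sub>0 where \<delta>0: "continuous_on UNIV \<delta>\<^sub>0" and div0: "has_divergence A \<phi> (vform F\<^sub>0) \<delta>\<^sub>0"
    using C1_volume_density_has_divergence[OF F0] by metis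
  define h\<^sub>0 where "h\<^sub>0 p = ln (F p / F\<^sub>0 p)" for p
  define k where "k p = \<delta> p - \<delta>\<^sub>0 p" for p
  have k: "continuous_on UNIV k"
    unfolding k_def[abs_def] by (intro continuous_intros \<delta> \<delta>0)
  have h0: "continuous_on UNIV h\<^sub>0"
    unfolding continuous_on_manifold_iff
  proof
    fix c assume c: "c \<in> A"
    let ?a = "vol_coeff A c (vform F)" and ?b = "vol_coeff A c (vform F\<^sub>0)"
    have pos: "?a x > 0" "?b x > 0" if "x \<in> cimg c" for x
      using vol_coeff_vform[OF c that] F(1) F0(1) det_tvec_pos[OF c cinv_in_cdom[OF c that]] by simp_all
    have "continuous_on (cimg c) (\<lambda>x. ln (?a x / ?b x))"
      by (intro continuous_intros F(2)[OF c] Ck_on_1_continuous[OF F0(2)[OF c]])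
         (use pos in \<open>auto simp: less_imp_neq[symmetric]\<close>)
    then show "continuous_on (cimg c) (\<lambda>x. h\<^sub>0 (cinv c x))"
    proof (rule continuous_on_eq)
      fix x assume x: "x \<in> cimg c"
      have "?a x / ?b x = F (cinv c x) / F\<^sub>0 (cinv c x)"
        unfolding vol_coeff_vform[OF c x]
        using det_tvec_pos[OF c cinv_in_cdom[OF c x]] by (intro mult_divide_mult_cancel_right) simp
      then show "ln (?a x / ?b x) = h\<^sub>0 (cinv c x)"
        by (simp only: h\<^sub>0_def)
    qed
  qed
  have h0_deriv0: "((\<lambda>t. h\<^sub>0 (\<phi> t p)) has_real_derivative k p) (at 0)" for p
  proof -
    \<comment> \<open>The Jacobian cancels in the quotient of the two pullbacks, as long as it does not vanish.\<close>
    have d: "((\<lambda>t. F (\<phi> t p) * jacobian t p) has_real_derivative \<delta> p * F p) (at 0)"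
      "((\<lambda>t. F\<^sub>0 (\<phi> t p) * jacobian t p) has_real_derivative \<delta>\<^sub>0 p * F\<^sub>0 p) (at 0)"
      using div div0 unfolding has_divergence_vform_iff by blast+
    have pos: "F p > 0" "F\<^sub>0 p > 0" by (rule F F0)+
    have q: "((\<lambda>t. (F (\<phi> t p) * jacobian t p) / (F\<^sub>0 (\<phi> t p) * jacobian t p)) has_real_derivative
        (\<delta> p * F p * F\<^sub>0 p - F p * (\<delta>\<^sub>0 p * F\<^sub>0 p)) / (F\<^sub>0 p * F\<^sub>0 p)) (at 0)"
      using DERIV_divide[OF d] pos by (simp add: flow_zero jacobian_zero)
    have "(ln has_real_derivative 1 / (F p / F\<^sub>0 p))
        (at ((F (\<phi> 0 p) * jacobian 0 p) / (F\<^sub>0 (\<phi> 0 p) * jacobian 0 p)))"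
      using DERIV_ln_divide[of "F p / F\<^sub>0 p"] pos by (simp add: flow_zero jacobian_zero)
    from DERIV_chain2[OF this q]
    have "((\<lambda>t. ln ((F (\<phi> t p) * jacobian t p) / (F\<^sub>0 (\<phi> t p) * jacobian t p))) has_real_derivative
        1 / (F p / F\<^sub>0 p) * ((\<delta> p * F p * F\<^sub>0 p - F p * (\<delta>\<^sub>0 p * F\<^sub>0 p)) / (F\<^sub>0 p * F\<^sub>0 p))) (at 0)" .
    also have "1 / (F p / F\<^sub>0 p) * ((\<delta> p * F p * F\<^sub>0 p - F p * (\<delta>\<^sub>0 p * F\<^sub>0 p)) / (F\<^sub>0 p * F\<^sub>0 p)) = k p"
      using pos by (simp add: k_def field_simps)
    finally have D: "((\<lambda>t. ln ((F (\<phi> t p) * jacobian t p) / (F\<^sub>0 (\<phi> t p) * jacobian t p))) has_real_derivative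
        k p) (at 0)" .
    show ?thesis
    proof (rule has_real_derivative_eventually_eq[OF D])
      show "\<forall>\<^sub>F t in at 0. ln ((F (\<phi> t p) * jacobian t p) / (F\<^sub>0 (\<phi> t p) * jacobian t p)) = h\<^sub>0 (\<phi> t p)"
      using eventually_jacobian_pos[of p] by eventually_elim (simp add: h\<^sub>0_def)
      show "ln ((F (\<phi> 0 p) * jacobian 0 p) / (F\<^sub>0 (\<phi> 0 p) * jacobian 0 p)) = h\<^sub>0 (\<phi> 0 p)"
      by (simp add: h\<^sub>0_def jacobian_zero)
    qed
  qed
  have h0_deriv: "((\<lambda>s. h\<^sub>0 (\<phi> s p)) has_real_derivative k (\<phi> t p)) (at t)" for t p
  proof -
    have "((\<lambda>s. h\<^sub>0 (\<phi> (s + t) p)) has_real_derivative k (\<phi> t p)) (at 0)"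
      using h0_deriv0[of "\<phi> t p"] by (simp add: flow_add)
    then show ?thesis using DERIV_shift[of "\<lambda>s. h\<^sub>0 (\<phi> s p)" "k (\<phi> t p)" 0 t] by simp
  qed
  \<comment> \<open>By compactness the variation of \<open>k\<close> along short orbit segments is uniformly small.\<close>
  obtain T where T: "T > 0" "\<And>s p. 0 < s \<Longrightarrow> s < T \<Longrightarrow> \<bar>k (\<phi> s p) - k p\<bar> < \<epsilon> / 2"
  proof -
    let ?W = "{z. \<bar>k (\<phi> (fst z) (snd z)) - k (snd z)\<bar> < \<epsilon> / 2}"
    have "continuous_on UNIV (\<lambda>z. \<bar>k (\<phi> (fst z) (snd z)) - k (snd z)\<bar>)"
      by (intro continuous_intros continuous_on_compose2[OF k]) auto
    then have "open ?W" by (intro open_Collect_less continuous_on_const)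
    moreover have "{0} \<times> UNIV \<subseteq> ?W" using \<epsilon> by (auto simp: flow_zero)
    ultimately have "\<exists>T0. 0 \<in> T0 \<and> open T0 \<and> T0 \<times> UNIV \<subseteq> ?W"
      by (rule Elementary_Topology.tube_lemma[OF compact_manifold])
    then obtain T0 where T0: "0 \<in> T0" "open T0" "T0 \<times> UNIV \<subseteq> ?W" by blast
    then obtain \<rho> where \<rho>: "\<rho> > 0" "ball 0 \<rho> \<subseteq> T0" unfolding open_contains_ball by blast
    show ?thesis
    proof (rule that[OF \<rho>(1)])
      fix s and p :: 'm assume "0 < s" "s < \<rho>"
      then have "(s, p) \<in> T0 \<times> UNIV" using \<rho>(2) by (auto simp: dist_real_def)
      then have "(s, p) \<in> ?W" using T0(3) by blast
      then show "\<bar>k (\<phi> s p) - k p\<bar> < \<epsilon> / 2" by simp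
    qed
  qed
  \<comment> \<open>Two such errors, divided by \<open>T\<close>, add up to at most \<open>\<epsilon> / 2\<close>.\<close>
  have "\<epsilon> * T / 4 > 0" using \<epsilon> T by simp
  from C1_functions_dense[OF h0 this]
  obtain h\<^sub>1 where h1: "C1_function h\<^sub>1" "\<And>p. \<bar>h\<^sub>0 p - h\<^sub>1 p\<bar> < \<epsilon> * T / 4" by metis
  define h where "h p = (1 / T) * integral {0..T} (\<lambda>s. h\<^sub>1 (\<phi> s p))" for p
  have h: "C1_function h"
    unfolding h_def[abs_def] by (intro C1_function_mult C1_function_const C1_function_flow_average h1)
  define k' where "k' p = (h\<^sub>1 (\<phi> T p) - h\<^sub>1 p) / T" for p
  have h_deriv: "((\<lambda>t. h (\<phi> t p)) has_real_derivative k' p) (at 0)" for p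
    using DERIV_cmult[OF flow_average_has_derivative[OF C1_function_continuous[OF h1(1)], of T p], of "1 / T"] T
    by (simp add: h_def k'_def)
  have close: "\<bar>k' p - k p\<bar> < \<epsilon>" for p
  proof -
    obtain s where s: "0 < s" "s < T" "h\<^sub>0 (\<phi> T p) - h\<^sub>0 (\<phi> 0 p) = (T - 0) * k (\<phi> s p)"
      using MVT2[OF T(1), of "\<lambda>t. h\<^sub>0 (\<phi> t p)" "\<lambda>t. k (\<phi> t p)"] h0_deriv by blast
    have "k' p - k p = (k (\<phi> s p) - k p) + ((h\<^sub>1 (\<phi> T p) - h\<^sub>0 (\<phi> T p)) + (h\<^sub>0 p - h\<^sub>1 p)) / T"
      using s(3) T(1) by (simp add: k'_def flow_zero field_simps)
    moreover have "\<bar>((h\<^sub>1 (\<phi> T p) - h\<^sub>0 (\<phi> T p)) + (h\<^sub>0 p - h\<^sub>1 p)) / T\<bar> \<le> \<epsilon> / 2"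
    proof -
      have "\<bar>(h\<^sub>1 (\<phi> T p) - h\<^sub>0 (\<phi> T p)) + (h\<^sub>0 p - h\<^sub>1 p)\<bar> \<le> \<epsilon> / 2 * T"
        using h1(2)[of p] h1(2)[of "\<phi> T p"] by linarith
      then show ?thesis using T(1) by (simp add: abs_divide divide_le_eq)
    qed
    ultimately show ?thesis using T(2)[OF s(1,2), of p] by linarith
  qed
  define F' where "F' p = F\<^sub>0 p * exp (h p)" for p
  have F': "F' p > 0" for p by (simp add: F'_def F0)
  have C1: "Ck_on 1 (vol_coeff A c (vform F')) (cimg c)" if c: "c \<in> A" for c
  proof -
    have "Ck_on 1 (exp :: real \<Rightarrow> real) UNIV"
      by (rule Ck_on_1_real[where f' = exp]) (auto intro: DERIV_exp continuous_intros)
    then have "Ck_on 1 (\<lambda>x. exp (h (cinv c x))) (cimg c)"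
      by (rule Ck_on_1_compose) (use h c in \<open>simp_all only: C1_function_def UNIV_I\<close>)
    from Ck_on_1_mult[OF F0(2)[OF c] this] show ?thesis
      by (rule Ck_on_1_transform[OF _ open_cimg[OF c]]) (simp add: vol_coeff_vform[OF c] F'_def)
  qed
  have "volume_form A (vform F')"
    by (rule volume_form_vform[OF F' Ck_on_1_continuous[OF C1]])
  then have "C1_volume_form A (vform F')"
    using C1 unfolding C1_volume_form_def by blast
  moreover have "has_divergence A \<phi> (vform F') (\<lambda>p. \<delta>\<^sub>0 p + k' p)"
    unfolding has_divergence_vform_iff
  proof
    fix p
    have "((\<lambda>t. F\<^sub>0 (\<phi> t p) * jacobian t p) has_real_derivative \<delta>\<^sub>0 p * F\<^sub>0 p) (at 0)"
      using div0 unfolding has_divergence_vform_iff by blast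
    from DERIV_mult[OF this DERIV_chain2[OF DERIV_exp h_deriv]]
    show "((\<lambda>t. F' (\<phi> t p) * jacobian t p) has_real_derivative (\<delta>\<^sub>0 p + k' p) * F' p) (at 0)"
      by (simp add: F'_def flow_zero jacobian_zero algebra_simps)
  qed
  moreover have "\<bar>(\<delta>\<^sub>0 p + k' p) - \<delta> p\<bar> < \<epsilon>" for p
    using close[of p] by (simp add: k_def algebra_simps)
  ultimately show ?thesis by (rule that)
qed

end

section \<open>Cosets and metrics\<close>

lemma coset_eq_iff: "coset X p v = coset X p w \<longleftrightarrow> (\<exists>a. v = w + a *\<^sub>R X p)"
proof
  assume "coset X p v = coset X p w"
  moreover have "v \<in> coset X p v" by (auto simp: coset_def intro: exI[of _ 0])
  ultimately show "\<exists>a. v = w + a *\<^sub>R X p" by (simp add: coset_def)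
next
  assume "\<exists>a. v = w + a *\<^sub>R X p"
  then obtain a where a: "v = w + a *\<^sub>R X p" by blast
  have "\<exists>b'. v + b *\<^sub>R X p = w + b' *\<^sub>R X p" for b
    by (rule exI[of _ "a + b"]) (simp add: a algebra_simps)
  moreover have "\<exists>b'. w + b *\<^sub>R X p = v + b' *\<^sub>R X p" for b
    by (rule exI[of _ "b - a"]) (simp add: a algebra_simps)
  ultimately show "coset X p v = coset X p w" by (auto simp: coset_def)
qed

lemma coset_sum: "{x + y | x y. x \<in> coset X p u \<and> y \<in> coset X p v} = coset X p (u + v)"
proof -
  have "\<exists>x y. u + v + a *\<^sub>R X p = x + y \<and> (\<exists>a. x = u + a *\<^sub>R X p) \<and> (\<exists>a. y = v + a *\<^sub>R X p)" for a
    by (rule exI[of _ "u + a *\<^sub>R X p"], rule exI[of _ v]) (auto intro: exI[of _ a] exI[of _ 0])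
  moreover have "\<exists>c. (u + a *\<^sub>R X p) + (v + b *\<^sub>R X p) = u + v + c *\<^sub>R X p" for a b
    by (rule exI[of _ "a + b"]) (simp add: algebra_simps)
  ultimately show ?thesis unfolding coset_def by blast
qed

text \<open>
  The function \<open>N'\<close> is the derivative of the norm along the flow, as provided by the
  differentiability of the norm.
\<close>

locale metric_flow = flow_on_manifold A X \<phi>
  for A :: "('m::t2_space) chart set" and X :: "'m \<Rightarrow> real^3" and \<phi> :: "real \<Rightarrow> 'm \<Rightarrow> 'm" +
  fixes g :: "'m \<Rightarrow> real^3 \<Rightarrow> real^3 \<Rightarrow> real" and N' :: "'m \<Rightarrow> real^3 \<Rightarrow> real"
  assumes X_nonzero: "X p \<noteq> 0"
    and metric: "riemannian_metric A g"
    and norm_deriv: "\<And>p v. v \<noteq> 0 \<Longrightarrow>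
      ((\<lambda>t. metric_norm g (\<phi> t p) (differential A (\<phi> t) p v)) has_real_derivative N' p v) (at 0)"
    and norm_deriv_continuous: "\<And>c. c \<in> A \<Longrightarrow>
      continuous_on (cimg c \<times> (- {0})) (\<lambda>(x, v). N' (cinv c x) (tvec A c (cinv c x) v))"
begin

lemma metric_bilinear: "bilinear (g p)" and metric_sym: "g p u v = g p v u"
  and metric_pos: "v \<noteq> 0 \<Longrightarrow> g p v v > 0"
  using metric by (simp_all add: riemannian_metric_def)

lemmas metric_simps = bilinear_ladd[OF metric_bilinear] bilinear_radd[OF metric_bilinear]
  bilinear_lmul[OF metric_bilinear] bilinear_rmul[OF metric_bilinear]
  bilinear_lsub[OF metric_bilinear] bilinear_rsub[OF metric_bilinear]
  bilinear_lzero[OF metric_bilinear] bilinear_rzero[OF metric_bilinear]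

lemma metric_nonneg: "g p v v \<ge> 0"
  using metric_pos[of v p] by (cases "v = 0") (auto simp: metric_simps less_imp_le)

lemma metric_XX_pos: "g p (X p) (X p) > 0"
  by (rule metric_pos[OF X_nonzero])

lemma metric_continuous:
  assumes c: "c \<in> A" and S: "S \<subseteq> cimg c"
    and u: "continuous_on S (vf_in_chart A c u)" and v: "continuous_on S (vf_in_chart A c v)"
  shows "continuous_on S (\<lambda>x. g (cinv c x) (u (cinv c x)) (v (cinv c x)))"
proof -
  let ?T = "\<lambda>x. tvec A c (cinv c x)"
  have lin: "linear (?T x)" if "x \<in> S" for x
    using linear_tvec[OF c cinv_in_cdom[OF c]] S that by blast
  have linr: "linear (\<lambda>w. g (cinv c x) y (?T x w))" and linl: "linear (\<lambda>w. g (cinv c x) (?T x w) y)"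
    if "x \<in> S" for x y
    using lin[OF that] by (auto intro!: linearI simp: linear_add linear_cmul metric_simps)
  have 1: "continuous_on S (\<lambda>x. g (cinv c x) (?T x b) (?T x (vf_in_chart A c v x)))"
    if b: "b \<in> Basis" for b
  proof (rule continuous_on_linear_family[where h = "\<lambda>x. x" and S = S
        and L = "\<lambda>x w. g (cinv c x) (?T x b) (?T x w)" and k = "vf_in_chart A c v"])
    fix b' :: "real^3" assume "b' \<in> Basis"
    then obtain i j where "b = axis i 1" "b' = axis j 1"
      using b by (auto simp: Basis_vec_def)
    then show "continuous_on S (\<lambda>x. g (cinv c x) (?T x b) (?T x b'))"
      using metric c S continuous_on_subset unfolding riemannian_metric_def by blast
  qed (use v linr in auto)
  have "continuous_on S (\<lambda>x. g (cinv c x) (?T x (vf_in_chart A c u x)) (?T x (vf_in_chart A c v x)))"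
    by (rule continuous_on_linear_family[where h = "\<lambda>x. x" and S = S
        and L = "\<lambda>x w. g (cinv c x) (?T x w) (?T x (vf_in_chart A c v x))" and k = "vf_in_chart A c u"])
       (use u linl 1 in auto)
  then show ?thesis
  proof (rule continuous_on_eq)
    fix x assume "x \<in> S"
    then have "cinv c x \<in> cdom c" using S cinv_in_cdom[OF c] by blast
    then show "g (cinv c x) (?T x (vf_in_chart A c u x)) (?T x (vf_in_chart A c v x)) =
        g (cinv c x) (u (cinv c x)) (v (cinv c x))"
      by (simp add: vf_in_chart_def tvec_tcoord[OF c])
  qed
qed

section \<open>The norm on the quotient along the flow\<close>

definition qnorm :: "'m \<Rightarrow> real^3 \<Rightarrow> real" where
  "qnorm p v = quotient_norm X g p (coset X p v)"

text \<open>
  The theorem of Pythagoras: the quotient norm is the length of the component orthogonal to \<open>X\<close>.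
\<close>

lemma qnorm_eq: "qnorm p v = sqrt (g p v v - (g p v (X p))\<^sup>2 / g p (X p) (X p))"
proof -
  let ?G = "g p (X p) (X p)"
  define w where "w = v - (g p v (X p) / ?G) *\<^sub>R X p"
  have G: "?G > 0" by (rule metric_XX_pos)
  have "coset X p v = coset X p w"
    unfolding coset_eq_iff by (rule exI[of _ "g p v (X p) / ?G"]) (simp add: w_def)
  moreover have orth: "g p w (X p) = 0"
    using G by (simp add: w_def metric_simps)
  moreover have "g p w w = g p v v - (g p v (X p))\<^sup>2 / ?G"
  proof -
    have "g p w w = g p w v" using orth by (simp add: w_def metric_simps)
    also have "\<dots> = g p v v - (g p v (X p))\<^sup>2 / ?G"
      using metric_sym[of p "X p" v] by (simp add: w_def metric_simps power2_eq_square)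
    finally show ?thesis .
  qed
  ultimately show ?thesis
    using quotient_norm_coset[of A g X p w, OF metric X_nonzero orth] by (simp add: qnorm_def metric_norm_def)
qed

text \<open>
  Only the norm is assumed to be differentiable along the flow; polarisation carries this over to the
  metric itself.
\<close>

lemma metric_differentiable_along_flow:
  "\<exists>D. ((\<lambda>t. g (\<phi> t p) (differential A (\<phi> t) p u) (differential A (\<phi> t) p v)) has_real_derivative D) (at 0)"
proof -
  let ?d = "\<lambda>t. differential A (\<phi> t) p"
  have sq: "\<exists>D. ((\<lambda>t. g (\<phi> t p) (?d t w) (?d t w)) has_real_derivative D) (at 0)" for w
  proof (cases "w = 0")
    case True
    then show ?thesis
      using linear_0[OF linear_differential] by (intro exI[of _ 0]) (simp add: metric_simps)
  next
    case False
    from DERIV_power[OF norm_deriv[OF this, of p], of 2] show ?thesis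
      by (auto simp: metric_norm_def metric_nonneg)
  qed
  from sq[of "u + v"] sq[of "u - v"] obtain D1 D2 where D:
    "((\<lambda>t. g (\<phi> t p) (?d t (u + v)) (?d t (u + v))) has_real_derivative D1) (at 0)"
    "((\<lambda>t. g (\<phi> t p) (?d t (u - v)) (?d t (u - v))) has_real_derivative D2) (at 0)"
    by blast
  from DERIV_cmult[OF DERIV_diff[OF D], of "1/4"]
  have "((\<lambda>t. 1/4 * (g (\<phi> t p) (?d t (u + v)) (?d t (u + v)) - g (\<phi> t p) (?d t (u - v)) (?d t (u - v))))
      has_real_derivative 1/4 * (D1 - D2)) (at 0)" .
  moreover have "1/4 * (g (\<phi> t p) (?d t (u + v)) (?d t (u + v)) - g (\<phi> t p) (?d t (u - v)) (?d t (u - v)))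
      = g (\<phi> t p) (?d t u) (?d t v)" for t
    unfolding linear_add[OF linear_differential] linear_diff[OF linear_differential] metric_simps
    using metric_sym[of "\<phi> t p" "?d t v" "?d t u"] by (simp add: algebra_simps)
  ultimately show ?thesis by auto
qed

text \<open>
  For a vector orthogonal to \<open>X\<close> the correction \<open>g(v, X)\<^sup>2 / g(X, X)\<close>, which separates the quotient norm from
  the norm, vanishes to second order at \<open>t = 0\<close>.  Hence both norms have the same derivative there.
\<close>

lemma qnorm_deriv:
  assumes orth: "g p v (X p) = 0" and unit: "g p v v = 1"
  shows "((\<lambda>t. qnorm (\<phi> t p) (differential A (\<phi> t) p v)) has_real_derivative N' p v) (at 0)"
proof -
  let ?d = "\<lambda>t. differential A (\<phi> t) p"
  let ?a = "\<lambda>t. g (\<phi> t p) (?d t v) (?d t v)" and ?b = "\<lambda>t. g (\<phi> t p) (?d t v) (?d t (X p))"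
    and ?e = "\<lambda>t. g (\<phi> t p) (?d t (X p)) (?d t (X p))"
  have v: "v \<noteq> 0" using unit by (auto simp: metric_simps)
  have "metric_norm g p v = 1" by (simp add: metric_norm_def unit)
  then have a: "(?a has_real_derivative 2 * N' p v) (at 0)"
    using DERIV_power[OF norm_deriv[OF v, of p], of 2]
    by (simp add: metric_norm_def metric_nonneg flow_zero differential_zero)
  obtain Db De where b: "(?b has_real_derivative Db) (at 0)" and e: "(?e has_real_derivative De) (at 0)"
    using metric_differentiable_along_flow[of p v "X p"] metric_differentiable_along_flow[of p "X p" "X p"] by blast
  have e0: "?e 0 \<noteq> 0"
    using metric_XX_pos[of p] by (simp add: flow_zero differential_zero)
  have b2: "((\<lambda>t. (?b t)\<^sup>2) has_real_derivative 0) (at 0)"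
    using DERIV_power[OF b, of 2] by (simp add: flow_zero differential_zero orth)
  have f: "((\<lambda>t. ?a t - (?b t)\<^sup>2 / ?e t) has_real_derivative 2 * N' p v) (at 0)"
    using DERIV_diff[OF a DERIV_divide[OF b2 e e0]] by (simp add: flow_zero differential_zero orth)
  have "(sqrt has_real_derivative 1 / 2) (at (?a 0 - (?b 0)\<^sup>2 / ?e 0))"
    using DERIV_real_sqrt[of 1] by (simp add: flow_zero differential_zero orth unit)
  from DERIV_chain2[OF this f]
  have "((\<lambda>t. sqrt (?a t - (?b t)\<^sup>2 / ?e t)) has_real_derivative N' p v) (at 0)"
    by simp
  then show ?thesis
    by (simp add: qnorm_eq differential_X)
qed

lemma differential_image_coset:
  "differential A (\<phi> t) p ` coset X p v = coset X (\<phi> t p) (differential A (\<phi> t) p v)"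
proof -
  have "differential A (\<phi> t) p (v + a *\<^sub>R X p) = differential A (\<phi> t) p v + a *\<^sub>R X (\<phi> t p)" for a
    by (simp add: linear_add[OF linear_differential] linear_cmul[OF linear_differential] differential_X)
  then show ?thesis by (auto simp: coset_def image_iff) metis
qed

section \<open>Unit vectors in a line subbundle and their expansion rate\<close>

text \<open>
  For a line bundle \<open>E\<close> in the quotient, these are the orthogonal representatives of the unit vectors of
  the fibre over \<open>p\<close>; there are exactly two of them, differing in sign.
\<close>

definition unit_rep :: "('m \<Rightarrow> (real^3) set set) \<Rightarrow> 'm \<Rightarrow> real^3 \<Rightarrow> bool" where
  "unit_rep E p v \<longleftrightarrow> coset X p v \<in> E p \<and> g p v (X p) = 0 \<and> g p v v = 1"

lemma qnorm_scaled_unit: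
  assumes "g p v (X p) = 0" "g p v v = 1"
  shows "qnorm p (a *\<^sub>R v + b *\<^sub>R X p) = \<bar>a\<bar>"
proof -
  have "g p (X p) v = 0" using assms(1) metric_sym by simp
  moreover have "g p (X p) (X p) \<noteq> 0" using metric_XX_pos[of p] by simp
  ultimately show ?thesis using assms
    by (simp add: qnorm_eq metric_simps power2_eq_square real_sqrt_abs2)
qed

context
  fixes E :: "'m \<Rightarrow> (real^3) set set"
  assumes line: "continuous_line_subbundle A X E"
begin

lemma local_spanning_section:
  "\<exists>U w. open U \<and> p \<in> U \<and> continuous_vf_on A U w \<and>
    (\<forall>q\<in>U. coset X q (w q) \<noteq> coset X q 0 \<and> E q = {coset X q (a *\<^sub>R w q) | a. True})"
  using line unfolding continuous_line_subbundle_def by (rule spec)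

lemma line_subbundle_fibre:
  obtains w where "E p = {coset X p (a *\<^sub>R w) | a. True}"
proof -
  obtain U w where "p \<in> U"
    "\<forall>q\<in>U. coset X q (w q) \<noteq> coset X q 0 \<and> E q = {coset X q (a *\<^sub>R w q) | a. True}"
    using local_spanning_section[of p] by (elim exE conjE) (rule that)
  then show ?thesis using that[of "w p"] by simp
qed

lemma zero_coset_in_fibre: "coset X p 0 \<in> E p"
proof -
  obtain w where "E p = {coset X p (a *\<^sub>R w) | a. True}" by (rule line_subbundle_fibre)
  then show ?thesis by (auto intro: exI[of _ 0])
qed

lemma fibre_coset:
  assumes v: "unit_rep E p v" and K: "K \<in> E p"
  obtains a where "K = coset X p (a *\<^sub>R v)"
proof -
  obtain w where w: "E p = {coset X p (a *\<^sub>R w) | a. True}" by (rule line_subbundle_fibre)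
  obtain a where "coset X p v = coset X p (a *\<^sub>R w)"
    using v w unfolding unit_rep_def by blast
  then obtain k where k: "v = a *\<^sub>R w + k *\<^sub>R X p" unfolding coset_eq_iff by blast
  have "a \<noteq> 0"
  proof
    assume "a = 0"
    then have "v = k *\<^sub>R X p" using k by simp
    then have "g p v v = k * g p v (X p)" by (simp add: metric_simps)
    then show False using v by (auto simp: unit_rep_def)
  qed
  obtain b where b: "K = coset X p (b *\<^sub>R w)" using K w by blast
  have "b *\<^sub>R w = (b / a) *\<^sub>R v + (- (b / a) * k) *\<^sub>R X p"
    using \<open>a \<noteq> 0\<close> by (simp add: k algebra_simps)
  then have "K = coset X p ((b / a) *\<^sub>R v)"
    unfolding b coset_eq_iff by blast
  then show ?thesis by (rule that)
qed

lemma scaled_coset_in_fibre: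
  assumes v: "coset X p v \<in> E p"
  shows "coset X p (b *\<^sub>R v) \<in> E p"
proof -
  obtain w where w: "E p = {coset X p (a *\<^sub>R w) | a. True}" by (rule line_subbundle_fibre)
  obtain a k where k: "v = a *\<^sub>R w + k *\<^sub>R X p"
    using v unfolding w by (auto simp: coset_eq_iff)
  have "coset X p (b *\<^sub>R v) = coset X p ((b * a) *\<^sub>R w)"
    unfolding coset_eq_iff by (rule exI[of _ "b * k"]) (simp add: k algebra_simps)
  then show ?thesis unfolding w by blast
qed

text \<open>
  The coefficient along the unit vector is known up to sign from the quotient norm; this is how the
  expansion factors enter determinants.
\<close>

lemma vector_in_fibre:
  assumes v: "unit_rep E p v" and z: "coset X p z \<in> E p"
  obtains a b where "z = a *\<^sub>R v + b *\<^sub>R X p" "\<bar>a\<bar> = qnorm p z"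
proof -
  obtain a where "coset X p z = coset X p (a *\<^sub>R v)" by (rule fibre_coset[OF v z])
  then obtain b where b: "z = a *\<^sub>R v + b *\<^sub>R X p" unfolding coset_eq_iff by blast
  then have "\<bar>a\<bar> = qnorm p z" using v by (simp add: qnorm_scaled_unit unit_rep_def)
  then show ?thesis using that b by blast
qed

text \<open>
  Projecting a local spanning section to the orthogonal complement of \<open>X\<close> and normalising it
  yields a continuous section of unit vectors.  Only local sections are used, since the signs of the
  local choices need not fit together.
\<close>

lemma local_unit_section:
  obtains U e where "open U" "p \<in> U" "continuous_vf_on A U e" "\<And>q. q \<in> U \<Longrightarrow> unit_rep E q (e q)"
proof -
  obtain U w where U: "open U" "p \<in> U" and w: "continuous_vf_on A U w"
    and "\<forall>q\<in>U. coset X q (w q) \<noteq> coset X q 0 \<and> E q = {coset X q (a *\<^sub>R w q) | a. True}"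
    using local_spanning_section[of p] by (elim exE conjE) (rule that)
  then have span: "\<And>q. q \<in> U \<Longrightarrow> coset X q (w q) \<noteq> coset X q 0"
      "\<And>q. q \<in> U \<Longrightarrow> E q = {coset X q (a *\<^sub>R w q) | a. True}"
    by simp_all
  define k where "k q = g q (w q) (X q) / g q (X q) (X q)" for q
  define n where "n q = w q - k q *\<^sub>R X q" for q
  define l where "l q = sqrt (g q (n q) (n q))" for q
  define e where "e q = (1 / l q) *\<^sub>R n q" for q
  have n_nonzero: "n q \<noteq> 0" if "q \<in> U" for q
    using span(1)[OF that] unfolding n_def coset_eq_iff by auto
  then have l_pos: "l q > 0" if "q \<in> U" for q
    using that metric_pos by (simp add: l_def)
  have orth: "g q (n q) (X q) = 0" for q
    using metric_XX_pos[of q] by (simp add: n_def k_def metric_simps)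
  have "unit_rep E q (e q)" if q: "q \<in> U" for q
  proof -
    have "e q = (1 / l q) *\<^sub>R w q + (- (1 / l q) * k q) *\<^sub>R X q"
      by (simp add: e_def n_def algebra_simps)
    then have "coset X q (e q) = coset X q ((1 / l q) *\<^sub>R w q)"
      unfolding coset_eq_iff by blast
    then have "coset X q (e q) \<in> E q" unfolding span(2)[OF q] by blast
    moreover have "g q (e q) (X q) = 0" by (simp add: e_def metric_simps orth)
    moreover have "l q * l q = g q (n q) (n q)"
      by (simp add: l_def metric_nonneg)
    then have "g q (e q) (e q) = (1 / l q) * ((1 / l q) * (l q * l q))"
      by (simp add: e_def metric_simps)
    then have "g q (e q) (e q) = 1" using l_pos[OF q] by simp
    ultimately show ?thesis unfolding unit_rep_def by blast
  qed
  moreover have "continuous_vf_on A U e"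
    unfolding continuous_vf_on_def
  proof
    fix c assume c: "c \<in> A"
    let ?S = "cmap c ` (cdom c \<inter> U)"
    have S: "?S \<subseteq> cimg c" by (auto simp: cimg_def)
    have inS: "cinv c x \<in> cdom c" "cinv c x \<in> U" if "x \<in> ?S" for x
      using that by (auto simp: cinv_cmap[OF c])
    have wc: "continuous_on ?S (vf_in_chart A c w)"
      using w c by (simp add: continuous_vf_on_def)
    have Xc: "continuous_on ?S (vf_in_chart A c X)"
      using continuous_on_subset[OF Ck_on_1_continuous[OF C1_X[OF c]] S] .
    have kc: "continuous_on ?S (\<lambda>x. k (cinv c x))"
      unfolding k_def using metric_XX_pos
      by (intro continuous_intros metric_continuous[OF c S] wc Xc) (simp add: less_imp_neq[symmetric])
    have oc: "continuous_on ?S (vf_in_chart A c n)"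
    proof (rule continuous_on_eq)
      show "continuous_on ?S (\<lambda>x. vf_in_chart A c w x - k (cinv c x) *\<^sub>R vf_in_chart A c X x)"
        by (intro continuous_intros wc Xc kc)
      show "vf_in_chart A c w x - k (cinv c x) *\<^sub>R vf_in_chart A c X x = vf_in_chart A c n x" if "x \<in> ?S" for x
        using linear_tcoord[OF c inS(1)[OF that]]
        by (simp add: vf_in_chart_def n_def linear_diff linear_cmul)
    qed
    show "continuous_on ?S (vf_in_chart A c e)"
    proof (rule continuous_on_eq)
      show "continuous_on ?S (\<lambda>x. (1 / l (cinv c x)) *\<^sub>R vf_in_chart A c n x)"
        using l_pos inS(2) unfolding l_def
        by (intro continuous_intros oc metric_continuous[OF c S]) (metis less_irrefl)
      show "(1 / l (cinv c x)) *\<^sub>R vf_in_chart A c n x = vf_in_chart A c e x" if "x \<in> ?S" for x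
        using linear_tcoord[OF c inS(1)[OF that]] by (simp add: vf_in_chart_def e_def linear_cmul)
    qed
  qed
  ultimately show ?thesis using that U by blast
qed

lemma ex_unit_rep: "\<exists>v. unit_rep E p v"
  using local_unit_section[of p] by metis

text \<open>
  The unit vector selected in the definition of the rate is the class of \<open>v\<close> or of \<open>- v\<close>, and both have
  the same norm at all times.
\<close>

lemma expansion_rate_eq:
  assumes v: "unit_rep E p v"
  shows "expansion_rate A \<phi> (quotient_norm X g) E p = N' p v"
proof -
  define K where "K = (SOME e. e \<in> E p \<and> quotient_norm X g p e = 1)"
  have "qnorm p v = 1"
    using v qnorm_scaled_unit[of p v 1 0] by (simp add: unit_rep_def)
  then have "coset X p v \<in> E p \<and> quotient_norm X g p (coset X p v) = 1"
    using v by (simp add: unit_rep_def qnorm_def)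
  then have K: "K \<in> E p" "quotient_norm X g p K = 1"
    using someI[of "\<lambda>e. e \<in> E p \<and> quotient_norm X g p e = 1"] unfolding K_def by blast+
  obtain a where a: "K = coset X p (a *\<^sub>R v)" by (rule fibre_coset[OF v K(1)])
  have "\<bar>a\<bar> = 1"
    using K(2) v qnorm_scaled_unit[of p v a 0] by (simp add: a qnorm_def[symmetric] unit_rep_def)
  have "quotient_norm X g (\<phi> t p) (flow_on_quotient A \<phi> t p K) = qnorm (\<phi> t p) (differential A (\<phi> t) p v)" for t
  proof -
    have "quotient_norm X g (\<phi> t p) (flow_on_quotient A \<phi> t p K) = qnorm (\<phi> t p) (a *\<^sub>R differential A (\<phi> t) p v)"
      by (simp add: flow_on_quotient_def a differential_image_coset linear_cmul[OF linear_differential] qnorm_def)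
    also have "\<dots> = qnorm (\<phi> t p) (differential A (\<phi> t) p v)"
      using \<open>\<bar>a\<bar> = 1\<close> by (auto simp: qnorm_eq metric_simps abs_if split: if_splits)
    finally show ?thesis .
  qed
  moreover have "((\<lambda>t. ln (qnorm (\<phi> t p) (differential A (\<phi> t) p v))) has_real_derivative N' p v) (at 0)"
  proof -
    have "(ln has_real_derivative 1) (at (qnorm (\<phi> 0 p) (differential A (\<phi> 0) p v)))"
      using DERIV_ln_divide[of 1] \<open>qnorm p v = 1\<close> by (simp add: flow_zero differential_zero)
    from DERIV_chain2[OF this qnorm_deriv] v show ?thesis by (simp add: unit_rep_def)
  qed
  ultimately show ?thesis
    unfolding expansion_rate_def K_def[symmetric] by (simp add: DERIV_imp_deriv)
qed

text \<open>
  Locally the rate is the derivative of the norm, evaluated at a continuous section of unit vectors.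
\<close>

lemma expansion_rate_continuous: "continuous_on UNIV (expansion_rate A \<phi> (quotient_norm X g) E)"
  unfolding continuous_on_manifold_iff
proof (intro ballI continuous_at_imp_continuous_on)
  fix c x assume c: "c \<in> A" and x: "x \<in> cimg c"
  let ?r = "expansion_rate A \<phi> (quotient_norm X g) E"
  obtain U e where U: "open U" "cinv c x \<in> U" and e: "continuous_vf_on A U e"
    and unit: "\<And>q. q \<in> U \<Longrightarrow> unit_rep E q (e q)"
    by (rule local_unit_section[of "cinv c x"]) blast
  let ?S = "cmap c ` (cdom c \<inter> U)"
  have S: "open ?S" "x \<in> ?S" "?S \<subseteq> cimg c"
    using open_cmap_image[OF c U(1)] x U(2) by (auto simp: cmap_image_eq[OF c])
  have inS: "cinv c y \<in> cdom c" "cinv c y \<in> U" if "y \<in> ?S" for y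
    using that by (auto simp: cinv_cmap[OF c])
  have "vf_in_chart A c e y \<noteq> 0" if y: "y \<in> ?S" for y
  proof
    assume "vf_in_chart A c e y = 0"
    then have "e (cinv c y) = 0"
      using tvec_tcoord(1)[OF c inS(1)[OF y], of "e (cinv c y)"] linear_0[OF linear_tvec[OF c inS(1)[OF y]]]
      by (simp add: vf_in_chart_def)
    then show False using unit[OF inS(2)[OF y]] by (simp add: unit_rep_def metric_simps)
  qed
  moreover have "continuous_on ?S (vf_in_chart A c e)"
    using e c by (simp add: continuous_vf_on_def)
  ultimately have "continuous_on ?S (\<lambda>y. case (y, vf_in_chart A c e y) of (x, v) \<Rightarrow>
      N' (cinv c x) (tvec A c (cinv c x) v))"
    using S(3) by (intro continuous_on_compose2[OF norm_deriv_continuous[OF c]] continuous_intros) auto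
  then have "continuous_on ?S (\<lambda>y. ?r (cinv c y))"
  proof (rule continuous_on_eq)
    fix y assume y: "y \<in> ?S"
    show "(case (y, vf_in_chart A c e y) of (x, v) \<Rightarrow> N' (cinv c x) (tvec A c (cinv c x) v)) = ?r (cinv c y)"
      using expansion_rate_eq[OF unit[OF inS(2)[OF y]]] tvec_tcoord(1)[OF c inS(1)[OF y]]
      by (simp add: vf_in_chart_def)
  qed
  then show "isCont (\<lambda>y. ?r (cinv c y)) x"
    using S continuous_on_eq_continuous_at by blast
qed

end

section \<open>The volume form of an invariant splitting\<close>

text \<open>
  A linear relation between \<open>X\<close>, \<open>u\<close> and \<open>v\<close> decomposes the zero coset into multiples of \<open>u\<close> and \<open>v\<close>, and the
  decomposition of the zero coset along the splitting is unique.
\<close>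

lemma transverse_unit_vectors:
  assumes line: "continuous_line_subbundle A X Es" "continuous_line_subbundle A X Eu"
    and split: "splits_quotient X Es Eu"
    and u: "unit_rep Es p u" and v: "unit_rep Eu p v"
  shows "triple (X p) u v \<noteq> 0"
proof (rule triple_nonzero)
  fix a b c assume rel: "a *\<^sub>R X p + b *\<^sub>R u + c *\<^sub>R v = 0"
  have "b *\<^sub>R u + c *\<^sub>R v = 0 + (- a) *\<^sub>R X p"
    using rel by (simp add: eq_neg_iff_add_eq_0 add_ac)
  then have sum: "coset X p 0 = coset X p (b *\<^sub>R u + c *\<^sub>R v)"
    using coset_eq_iff by metis
  have mem: "coset X p (b *\<^sub>R u) \<in> Es p" "coset X p (c *\<^sub>R v) \<in> Eu p"
    using u v line by (auto simp: unit_rep_def intro: scaled_coset_in_fibre)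
  have zero: "coset X p 0 \<in> Es p" "coset X p 0 \<in> Eu p"
    using line by (auto intro: zero_coset_in_fibre)
  have ex1: "\<exists>!KL \<in> Es p \<times> Eu p. coset X p 0 = {x + y | x y. x \<in> fst KL \<and> y \<in> snd KL}"
    by (rule split[unfolded splits_quotient_def, THEN spec, THEN spec])
  have unique: "K = L" if "K \<in> Es p \<times> Eu p" "coset X p 0 = {x + y | x y. x \<in> fst K \<and> y \<in> snd K}"
      "L \<in> Es p \<times> Eu p" "coset X p 0 = {x + y | x y. x \<in> fst L \<and> y \<in> snd L}" for K L
    by (rule trans[OF the1_equality[OF ex1 conjI[OF that(1,2)], symmetric] the1_equality[OF ex1 conjI[OF that(3,4)]]])
  have "(coset X p (b *\<^sub>R u), coset X p (c *\<^sub>R v)) = (coset X p 0, coset X p 0)"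
  proof (rule unique)
  qed (simp_all add: mem zero coset_sum sum[symmetric])
  then have eq: "coset X p (b *\<^sub>R u) = coset X p 0" "coset X p (c *\<^sub>R v) = coset X p 0" by auto
  have scalar_zero: "r = 0" if w: "coset X p (r *\<^sub>R w) = coset X p 0" "g p w (X p) = 0" "g p w w = 1" for r w
  proof -
    obtain k where k: "r *\<^sub>R w = k *\<^sub>R X p" using w(1) unfolding coset_eq_iff by auto
    have "r = g p w (r *\<^sub>R w)" using w(3) by (simp add: metric_simps)
    also have "\<dots> = 0" using w(2) unfolding k by (simp add: metric_simps)
    finally show ?thesis .
  qed
  have "b = 0" "c = 0"
    using scalar_zero[OF eq(1)] scalar_zero[OF eq(2)] u v by (auto simp: unit_rep_def)
  then show "a = 0 \<and> b = 0 \<and> c = 0" using rel X_nonzero[of p] by simp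
qed

lemma flow_maps_unit_rep:
  assumes line: "continuous_line_subbundle A X E"
    and inv: "flow_on_quotient A \<phi> t p ` E p = E (\<phi> t p)"
    and v: "unit_rep E p v" and w: "unit_rep E (\<phi> t p) w"
  obtains a b where "differential A (\<phi> t) p v = a *\<^sub>R w + b *\<^sub>R X (\<phi> t p)"
    "\<bar>a\<bar> = qnorm (\<phi> t p) (differential A (\<phi> t) p v)"
proof -
  have "flow_on_quotient A \<phi> t p (coset X p v) \<in> E (\<phi> t p)"
    using v unfolding inv[symmetric] unit_rep_def by blast
  then have "coset X (\<phi> t p) (differential A (\<phi> t) p v) \<in> E (\<phi> t p)"
    by (simp add: flow_on_quotient_def differential_image_coset)
  then show ?thesis using vector_in_fibre[OF line w] that by metis
qed

text \<open>
  The density is the reciprocal of \<open>\<bar>det (X, e\<^sub>s, e\<^sub>u)\<bar>\<close>, so that \<open>X\<close> and the two unit vectors span a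
  parallelepiped of volume \<open>1\<close>.  The absolute value removes the sign ambiguity of the unit vectors, and the
  orientation of the manifold provides the sign of the form.
\<close>

lemma ex_volume_density_with_divergence_sum_of_rates:
  assumes line: "continuous_line_subbundle A X Es" "continuous_line_subbundle A X Eu"
    and split: "splits_quotient X Es Eu"
    and inv: "\<And>t p. flow_on_quotient A \<phi> t p ` Es p = Es (\<phi> t p)"
      "\<And>t p. flow_on_quotient A \<phi> t p ` Eu p = Eu (\<phi> t p)"
  obtains F where "\<And>p. F p > 0" "\<And>c. c \<in> A \<Longrightarrow> continuous_on (cimg c) (vol_coeff A c (vform F))"
    "has_divergence A \<phi> (vform F)
      (\<lambda>p. expansion_rate A \<phi> (quotient_norm X g) Es p + expansion_rate A \<phi> (quotient_norm X g) Eu p)"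
proof -
  obtain es eu where unit: "\<And>p. unit_rep Es p (es p)" "\<And>p. unit_rep Eu p (eu p)"
    using ex_unit_rep[OF line(1)] ex_unit_rep[OF line(2)] by metis
  define F where "F p = 1 / \<bar>triple (X p) (es p) (eu p)\<bar>" for p
  have nonzero: "triple (X p) u v \<noteq> 0" if "unit_rep Es p u" "unit_rep Eu p v" for p u v
    by (rule transverse_unit_vectors[OF line split that])
  have F_pos: "F p > 0" for p using nonzero[OF unit] by (simp add: F_def)
  have triple_shear: "triple (X p) (a *\<^sub>R u + b *\<^sub>R X p) (a' *\<^sub>R v + b' *\<^sub>R X p) = a * a' * triple (X p) u v"
    for p u v a b a' b'
    by (simp add: triple_add triple_scale triple_alternating)
  have F_eq: "F p = 1 / \<bar>triple (X p) u v\<bar>" if u: "unit_rep Es p u" and v: "unit_rep Eu p v" for p u v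
  proof -
    have one: "qnorm p u = 1" "qnorm p v = 1"
      using u v qnorm_scaled_unit[of p u 1 0] qnorm_scaled_unit[of p v 1 0] by (simp_all add: unit_rep_def)
    obtain a b where a: "u = a *\<^sub>R es p + b *\<^sub>R X p" "\<bar>a\<bar> = qnorm p u"
      using vector_in_fibre[OF line(1) unit(1)] u unfolding unit_rep_def by blast
    obtain a' b' where a': "v = a' *\<^sub>R eu p + b' *\<^sub>R X p" "\<bar>a'\<bar> = qnorm p v"
      using vector_in_fibre[OF line(2) unit(2)] v unfolding unit_rep_def by blast
    show ?thesis
      using a(2) a'(2) by (simp add: a(1) a'(1) triple_shear abs_mult F_def one[unfolded a(1) a'(1)])
  qed
  have coeff: "continuous_on (cimg c) (vol_coeff A c (vform F))" if c: "c \<in> A" for c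
  proof (rule continuous_at_imp_continuous_on, rule ballI)
    fix x assume x: "x \<in> cimg c"
    obtain U u where U: "open U" "cinv c x \<in> U" and u: "continuous_vf_on A U u" "\<And>q. q \<in> U \<Longrightarrow> unit_rep Es q (u q)"
      by (rule local_unit_section[OF line(1), of "cinv c x"]) blast
    obtain V v where V: "open V" "cinv c x \<in> V" and v: "continuous_vf_on A V v" "\<And>q. q \<in> V \<Longrightarrow> unit_rep Eu q (v q)"
      by (rule local_unit_section[OF line(2), of "cinv c x"]) blast
    let ?S = "cmap c ` (cdom c \<inter> (U \<inter> V))"
    have S: "open ?S" "x \<in> ?S"
      using open_cmap_image[OF c open_Int[OF U(1) V(1)]] x U(2) V(2) by (auto simp: cmap_image_eq[OF c])
    have inS: "y \<in> cimg c" "cinv c y \<in> cdom c" "cinv c y \<in> U" "cinv c y \<in> V" if "y \<in> ?S" for y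
      using that by (auto simp: cinv_cmap[OF c] cmap_in_cimg[OF c])
    let ?t = "\<lambda>y. triple (vf_in_chart A c X y) (vf_in_chart A c u y) (vf_in_chart A c v y)"
    have t_eq: "?t y = det (matrix (tcoord A c (cinv c y))) * triple (X (cinv c y)) (u (cinv c y)) (v (cinv c y))"
      if "y \<in> ?S" for y
      unfolding vf_in_chart_def by (rule triple_linear_image[OF linear_tcoord[OF c inS(2)[OF that]]])
    have t_nonzero: "?t y \<noteq> 0" if "y \<in> ?S" for y
      using t_eq[OF that] det_tcoord_pos[OF c inS(2)[OF that]]
        nonzero[OF u(2)[OF inS(3)[OF that]] v(2)[OF inS(4)[OF that]]] by simp
    have "continuous_on ?S (vf_in_chart A c X)"
      by (rule continuous_on_subset[OF Ck_on_1_continuous[OF C1_X[OF c]]]) (auto simp: cimg_def)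
    moreover have "continuous_on ?S (vf_in_chart A c u)" "continuous_on ?S (vf_in_chart A c v)"
      using u(1) v(1) c by (auto simp: continuous_vf_on_def intro: continuous_on_subset)
    ultimately have "continuous_on ?S (\<lambda>y. 1 / \<bar>?t y\<bar>)"
      using t_nonzero by (intro continuous_intros continuous_on_triple) simp_all
    then have "continuous_on ?S (vol_coeff A c (vform F))"
    proof (rule continuous_on_eq)
      fix y assume y: "y \<in> ?S"
      define d where "d = det (matrix (tcoord A c (cinv c y)))"
      have d: "d > 0" "d * det (matrix (tvec A c (cinv c y))) = 1"
        unfolding d_def using det_tcoord_pos[OF c inS(2)[OF y]] det_tcoord_tvec_self[OF c inS(2)[OF y]] by auto
      have "1 / \<bar>?t y\<bar> = F (cinv c y) * (1 / d)"
        using d(1) t_eq[OF y]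
        by (simp add: F_eq[OF u(2)[OF inS(3)[OF y]] v(2)[OF inS(4)[OF y]]] abs_mult d_def[symmetric])
      also have "1 / d = det (matrix (tvec A c (cinv c y)))"
        using d by (simp add: field_simps)
      finally show "1 / \<bar>?t y\<bar> = vol_coeff A c (vform F) y"
        by (simp only: vol_coeff_vform[OF c inS(1)[OF y]])
    qed
    then show "isCont (vol_coeff A c (vform F)) x"
      using S continuous_on_eq_continuous_at by blast
  qed
  have "has_divergence A \<phi> (vform F)
      (\<lambda>p. expansion_rate A \<phi> (quotient_norm X g) Es p + expansion_rate A \<phi> (quotient_norm X g) Eu p)"
    unfolding has_divergence_vform_iff
  proof
    fix p
    let ?ns = "\<lambda>t. qnorm (\<phi> t p) (differential A (\<phi> t) p (es p))"
    let ?nu = "\<lambda>t. qnorm (\<phi> t p) (differential A (\<phi> t) p (eu p))"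
    have n0: "?ns 0 = 1" "?nu 0 = 1"
      using unit[of p] qnorm_scaled_unit[of p "es p" 1 0] qnorm_scaled_unit[of p "eu p" 1 0]
      by (simp_all add: unit_rep_def flow_zero differential_zero)
    \<comment> \<open>The flow changes the volume of the parallelepiped spanned by \<open>X\<close>, \<open>e\<^sub>s\<close>, \<open>e\<^sub>u\<close> by the product of the two expansion factors.\<close>
    have pullback: "?ns t * ?nu t * F p = F (\<phi> t p) * jacobian t p" if J: "jacobian t p > 0" for t
    proof -
      let ?d = "differential A (\<phi> t) p" and ?q = "\<phi> t p"
      obtain a b where a: "?d (es p) = a *\<^sub>R es ?q + b *\<^sub>R X ?q" "\<bar>a\<bar> = ?ns t"
        by (rule flow_maps_unit_rep[OF line(1) inv(1) unit(1) unit(1)])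
      obtain a' b' where a': "?d (eu p) = a' *\<^sub>R eu ?q + b' *\<^sub>R X ?q" "\<bar>a'\<bar> = ?nu t"
        by (rule flow_maps_unit_rep[OF line(2) inv(2) unit(2) unit(2)])
      have "jacobian t p * triple (X p) (es p) (eu p) = a * a' * triple (X ?q) (es ?q) (eu ?q)"
        using triple_differential[of t p "X p" "es p" "eu p"] by (simp add: differential_X a(1) a'(1) triple_shear)
      then have "jacobian t p * \<bar>triple (X p) (es p) (eu p)\<bar> = ?ns t * ?nu t * \<bar>triple (X ?q) (es ?q) (eu ?q)\<bar>"
        unfolding a(2)[symmetric] a'(2)[symmetric] using J by (metis abs_mult abs_of_pos)
      moreover have "\<bar>triple (X p) (es p) (eu p)\<bar> \<noteq> 0" "\<bar>triple (X ?q) (es ?q) (eu ?q)\<bar> \<noteq> 0"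
        using nonzero[OF unit] by simp_all
      ultimately show ?thesis by (simp add: F_def field_simps)
    qed
    have "(?ns has_real_derivative N' p (es p)) (at 0)" "(?nu has_real_derivative N' p (eu p)) (at 0)"
      using qnorm_deriv unit[of p] by (simp_all add: unit_rep_def)
    from DERIV_cmult_right[OF DERIV_mult[OF this], of "F p"]
    have D: "((\<lambda>t. ?ns t * ?nu t * F p) has_real_derivative (N' p (es p) + N' p (eu p)) * F p) (at 0)"
      using n0 by simp
    have "((\<lambda>t. F (\<phi> t p) * jacobian t p) has_real_derivative (N' p (es p) + N' p (eu p)) * F p) (at 0)"
    proof (rule has_real_derivative_eventually_eq[OF D])
      show "\<forall>\<^sub>F t in at 0. ?ns t * ?nu t * F p = F (\<phi> t p) * jacobian t p"
        using eventually_jacobian_pos[of p] by eventually_elim (rule pullback)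
      show "?ns 0 * ?nu 0 * F p = F (\<phi> 0 p) * jacobian 0 p"
        by (rule pullback) (simp add: jacobian_zero)
    qed
    then show "((\<lambda>t. F (\<phi> t p) * jacobian t p) has_real_derivative
        (expansion_rate A \<phi> (quotient_norm X g) Es p + expansion_rate A \<phi> (quotient_norm X g) Eu p) * F p) (at 0)"
      by (simp only: expansion_rate_eq[OF line(1) unit(1)] expansion_rate_eq[OF line(2) unit(2)])
  qed
  with F_pos coeff show ?thesis by (rule that)
qed

end

theorem theorem1p2:
  fixes A :: "('m::t2_space) chart set"
    and X :: "'m \<Rightarrow> real^3"
    and \<phi> :: "real \<Rightarrow> 'm \<Rightarrow> 'm"
    and Es Eu :: "'m \<Rightarrow> (real^3) set set"
    and g :: "'m \<Rightarrow> real^3 \<Rightarrow> real^3 \<Rightarrow> real"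
    and r\<^sub>s r\<^sub>u :: "'m \<Rightarrow> real"
  assumes "closed_connected_oriented_3manifold A"
    and "C1plus_vf A X"
    and "\<forall>p. X p \<noteq> 0"
    and "flow_of A X \<phi>"
    and "projectively_anosov A X \<phi> Es Eu"
    and "transversely_orientable A (plane_field_of Es)"
    and "transversely_orientable A (plane_field_of Eu)"
    and "riemannian_metric A g"
    and "X_differentiable_norm A \<phi> (metric_norm g)"
    and "r\<^sub>s = expansion_rate A \<phi> (quotient_norm X g) Es"
    and "r\<^sub>u = expansion_rate A \<phi> (quotient_norm X g) Eu"
  shows "(\<exists>\<Omega>. volume_form A \<Omega> \<and> X_differentiable_form A \<phi> \<Omega> \<and>
              has_divergence A \<phi> \<Omega> (\<lambda>p. r\<^sub>s p + r\<^sub>u p)) \<and>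
         (\<forall>\<epsilon>>0. \<exists>\<Omega> \<delta>. C1_volume_form A \<Omega> \<and> has_divergence A \<phi> \<Omega> \<delta> \<and>
              (\<forall>p. \<bar>\<delta> p - (r\<^sub>s p + r\<^sub>u p)\<bar> < \<epsilon>))"
proof -
  obtain N' where N': "\<forall>p v. v \<noteq> 0 \<longrightarrow>
      ((\<lambda>t. metric_norm g (\<phi> t p) (differential A (\<phi> t) p v)) has_real_derivative N' p v) (at 0)"
    "\<forall>c\<in>A. continuous_on (cimg c \<times> (- {0})) (\<lambda>(x, v). N' (cinv c x) (tvec A c (cinv c x) v))"
    using assms(9) unfolding X_differentiable_norm_def by blast
  interpret metric_flow A X \<phi> g N'
  proof
    show "oriented_smooth_atlas A" "compact (UNIV :: 'm set)"
      using assms(1) by (simp_all add: closed_connected_oriented_3manifold_def)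
    show "Ck_on 1 (vf_in_chart A c X) (cimg c)" if "c \<in> A" for c
      using assms(2) that unfolding C1plus_vf_def by blast
  qed (use assms(3,4,8) N' in blast)+
  have bundles: "continuous_line_subbundle A X Es" "continuous_line_subbundle A X Eu"
    and split: "splits_quotient X Es Eu"
    and invariant: "\<And>t p. flow_on_quotient A \<phi> t p ` Es p = Es (\<phi> t p)"
      "\<And>t p. flow_on_quotient A \<phi> t p ` Eu p = Eu (\<phi> t p)"
    using assms(5) by (simp_all add: projectively_anosov_def)
  let ?\<delta> = "\<lambda>p. r\<^sub>s p + r\<^sub>u p"
  have \<delta>: "continuous_on UNIV ?\<delta>"
    unfolding assms(10,11) by (intro continuous_on_add expansion_rate_continuous bundles)
  obtain F where F: "\<And>p. F p > 0" "\<And>c. c \<in> A \<Longrightarrow> continuous_on (cimg c) (vol_coeff A c (vform F))"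
    and div: "has_divergence A \<phi> (vform F) ?\<delta>"
    using ex_volume_density_with_divergence_sum_of_rates[OF bundles split invariant]
    unfolding assms(10,11) by metis
  have "X_differentiable_form A \<phi> (vform F)"
    unfolding X_differentiable_form_def
  proof (intro exI conjI ballI)
    show "has_lie_derivative A \<phi> (vform F) (\<lambda>p u v w. ?\<delta> p * vform F p u v w)"
      using div unfolding has_divergence_def .
    fix c assume c: "c \<in> A"
    have "continuous_on (cimg c) (\<lambda>x. ?\<delta> (cinv c x))"
      using \<delta> c unfolding continuous_on_manifold_iff by (rule bspec)
    from continuous_on_mult[OF this F(2)[OF c]]
    show "continuous_on (cimg c) (vol_coeff A c (\<lambda>p u v w. ?\<delta> p * vform F p u v w))"
      unfolding vol_coeff_def[abs_def] .
  qed
  with volume_form_vform[OF F] div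
  have "\<exists>\<Omega>. volume_form A \<Omega> \<and> X_differentiable_form A \<phi> \<Omega> \<and> has_divergence A \<phi> \<Omega> ?\<delta>"
    by blast
  moreover have "\<exists>\<Omega> \<delta>. C1_volume_form A \<Omega> \<and> has_divergence A \<phi> \<Omega> \<delta> \<and> (\<forall>p. \<bar>\<delta> p - ?\<delta> p\<bar> < \<epsilon>)"
    if "\<epsilon> > 0" for \<epsilon>
    by (rule C1_volume_form_with_nearby_divergence[OF F div \<delta> that]) blast+
  ultimately show ?thesis by blast
qed

end
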